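(* Let $(\Omega,\mathcal E_\Omega)$ be a finite-dimensional generalized probabilistic theory whose state space $\Omega$ is transitive and whose positive cone $V_+$ is self-dual with respect to $\langle\cdot,\cdot\rangle_{GL(\Omega)}$. Let $F=\{f_a\}_{a\in A}$ and $G=\{g_b\}_{b\in B}$ be ideal observables on $\Omega$, whose outcome sets $(A,d_A)$ and $(B,d_B)$ are finite metric spaces, and let $\widetilde M^{FG}=\{\widetilde m^{FG}_{ab}\}_{(a,b)\in A\times B}$ be an arbitrary observable on $A\times B$ (an approximate joint observable of $(F,G)$) with marginals $\widetilde M^F=\{\sum_{b}\widetilde m^{FG}_{ab}\}_{a\in A}$ and $\widetilde M^G=\{\sum_a\widetilde m^{FG}_{ab}\}_{b\in B}$. Then for all $\epsilon_1,\epsilon_2\in[0,1]$ with $\epsilon_1+\epsilon_2\le 1$ there exists a state $\omega\in\Omega$ such that $$\mathcal W_{\epsilon_1}(\widetilde M^F,F)\ge W_{\epsilon_1+\epsilon_2}(\omega^F),\qquad \mathcal W_{\epsilon_2}(\widetilde M^G,G)\ge W_{\epsilon_1+\epsilon_2}(\omega^G).$$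
   Context: Setting: $V=\mathbb R^{N+1}$ with Euclidean inner product $(\cdot,\cdot)_E$. A state space $\Omega\subset V$ is a compact convex set with $\mathrm{span}(\Omega)=V$ and $0\notin\mathrm{aff}(\Omega)$; $V_+=\{\lambda\omega:\lambda\ge0,\omega\in\Omega\}$; the unit effect $u\in V^*$ satisfies $u(\omega)=1$ for all $\omega\in\Omega$; effects are $\mathcal E_\Omega=\{e\in V^*:0\le e(\omega)\le1\ \forall\omega\in\Omega\}$. An observable with finite outcome set $X$ is a family $\{e_x\}_{x\in X}$ of effects with $\sum_x e_x=u$ (the trivial observable $\{u\}$ is not considered). $\Omega^{\mathrm{ext}}$ denotes the extreme points of $\Omega$. An effect is pure if it is an extreme point of $\mathcal E_\Omega$, and indecomposable if $e\neq0$ and any decomposition $e=e_1+e_2$ with $e_1,e_2\in\mathcal E_\Omega$ forces $e_1,e_2$ to be scalar multiples of $e$. An observable $F=\{f_a\}_{a\in A}$ is ideal if for each $a$, either $f_a=\sum_{i\in I_a}e_i$ or $f_a=u-\sum_{i\in I_a}e_i$ for a finite family $\{e_i\}_{i\in I_a}$ of pure indecomposable effects. $GL(\Omega)$ is the (compact) group of linear bijections $T:V\to V$ with $T(\Omega)=\Omega$, $\mu$ its normalized Haar measure, and $\langle x,y\rangle_{GL(\Omega)}=\int_{GL(\Omega)}(Tx,Ty)_E\,d\mu(T)$. $\Omega$ is transitive if $GL(\Omega)$ acts transitively on $\Omega^{\mathrm{ext}}$. The internal dual cone is $V^{*int}_+=\{y\in V:\langle x,y\rangle_{GL(\Omega)}\ge0\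 \forall x\in V_+\}$, and $V_+$ is self-dual with respect to $\langle\cdot,\cdot\rangle_{GL(\Omega)}$ if $V_+=V^{*int}_+$. For a state $\omega$ and observable $F$, $\omega^F=\{f_a(\omega)\}_{a\in A}$. For a finite metric space $(A,d_A)$, $O_{d_A}(a;w)=\{x\in A:d_A(x,a)\le w/2\}$. Overall width: $W_\epsilon(\omega^F)=\inf\{w>0:\exists a\in A,\ \sum_{a'\in O_{d_A}(a;w)}f_{a'}(\omega)\ge1-\epsilon\}$. Error bar width of an observable $\widetilde F=\{\widetilde f_a\}_{a\in A}$ relative to ideal $F$: $\mathcal W_\epsilon(\widetilde F,F)=\inf\{w>0:\forall a\in A,\forall\omega\in\Omega,\ f_a(\omega)=1\Rightarrow\sum_{a'\in O_{d_A}(a;w)}\widetilde f_{a'}(\omega)\ge1-\epsilon\}$. *)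

theory Defs
  imports "HOL-Probability.Probability"
begin

text \<open>Generalized probabilistic theories. The ambient space V = R^(N+1) is an arbitrary
  euclidean_space type 'v (dimension DIM('v) = N+1 >= 1) with its standard inner product.
  Elements of the dual space V* are represented as linear functionals 'v => real.\<close>

definition state_space :: "'v::euclidean_space set \<Rightarrow> bool" where
  "state_space \<Omega> \<longleftrightarrow> compact \<Omega> \<and> convex \<Omega> \<and> span \<Omega> = UNIV \<and> 0 \<notin> affine hull \<Omega>"

definition unit_effect :: "'v::euclidean_space set \<Rightarrow> ('v \<Rightarrow> real)" where
  "unit_effect \<Omega> = (THE u. linear u \<and> (\<forall>\<omega>\<in>\<Omega>. u \<omega> = 1))"

definition effects :: "'v::euclidean_space set \<Rightarrow> ('v \<Rightarrow> real) set" where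
  "effects \<Omega> = {e. linear e \<and> (\<forall>\<omega>\<in>\<Omega>. 0 \<le> e \<omega> \<and> e \<omega> \<le> 1)}"

text \<open>Observable with finite outcome set X; the trivial observable (single outcome, {u}) is excluded.\<close>
definition observable :: "'v::euclidean_space set \<Rightarrow> 'x set \<Rightarrow> ('x \<Rightarrow> 'v \<Rightarrow> real) \<Rightarrow> bool" where
  "observable \<Omega> X e \<longleftrightarrow> finite X \<and> card X \<ge> 2 \<and> (\<forall>x\<in>X. e x \<in> effects \<Omega>)
     \<and> (\<lambda>v. \<Sum>x\<in>X. e x v) = unit_effect \<Omega>"

definition pure_effect :: "'v::euclidean_space set \<Rightarrow> ('v \<Rightarrow> real) \<Rightarrow> bool" where
  "pure_effect \<Omega> e \<longleftrightarrow> e \<in> effects \<Omega> \<and>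
     \<not> (\<exists>e1\<in>effects \<Omega>. \<exists>e2\<in>effects \<Omega>. e1 \<noteq> e2 \<and>
          (\<exists>t::real. 0 < t \<and> t < 1 \<and> e = (\<lambda>v. t * e1 v + (1 - t) * e2 v)))"

definition indecomposable_effect :: "'v::euclidean_space set \<Rightarrow> ('v \<Rightarrow> real) \<Rightarrow> bool" where
  "indecomposable_effect \<Omega> e \<longleftrightarrow> e \<noteq> (\<lambda>v. 0) \<and>
     (\<forall>e1\<in>effects \<Omega>. \<forall>e2\<in>effects \<Omega>. e = (\<lambda>v. e1 v + e2 v) \<longrightarrow>
        (\<exists>c::real. e1 = (\<lambda>v. c * e v)) \<and> (\<exists>c::real. e2 = (\<lambda>v. c * e v)))"

definition ideal_observable :: "'v::euclidean_space set \<Rightarrow> 'x set \<Rightarrow> ('x \<Rightarrow> 'v \<Rightarrow> real) \<Rightarrow> bool" where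
  "ideal_observable \<Omega> X f \<longleftrightarrow> observable \<Omega> X f \<and>
     (\<forall>a\<in>X. \<exists>es :: ('v \<Rightarrow> real) list.
        (\<forall>e\<in>set es. pure_effect \<Omega> e \<and> indecomposable_effect \<Omega> e) \<and>
        (f a = (\<lambda>v. \<Sum>e\<leftarrow>es. e v) \<or> f a = (\<lambda>v. unit_effect \<Omega> v - (\<Sum>e\<leftarrow>es. e v))))"

definition GL :: "'v::euclidean_space set \<Rightarrow> ('v \<Rightarrow>\<^sub>L 'v) set" where
  "GL \<Omega> = {T. bij (blinfun_apply T) \<and> blinfun_apply T ` \<Omega> = \<Omega>}"

definition is_haar_GL :: "'v::euclidean_space set \<Rightarrow> ('v \<Rightarrow>\<^sub>L 'v) measure \<Rightarrow> bool" where
  "is_haar_GL \<Omega> \<mu> \<longleftrightarrow> sets \<mu> = sets borel \<and> prob_space \<mu> \<and> (AE T in \<mu>. T \<in> GL \<Omega>) \<and>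
     (\<forall>S\<in>GL \<Omega>. distr \<mu> borel (\<lambda>T. S o\<^sub>L T) = \<mu>)"

definition haar_GL :: "'v::euclidean_space set \<Rightarrow> ('v \<Rightarrow>\<^sub>L 'v) measure" where
  "haar_GL \<Omega> = (THE \<mu>. is_haar_GL \<Omega> \<mu>)"

definition inner_GL :: "'v::euclidean_space set \<Rightarrow> 'v \<Rightarrow> 'v \<Rightarrow> real" where
  "inner_GL \<Omega> x y = (\<integral>T. inner (blinfun_apply T x) (blinfun_apply T y) \<partial>haar_GL \<Omega>)"

definition transitive_state_space :: "'v::euclidean_space set \<Rightarrow> bool" where
  "transitive_state_space \<Omega> \<longleftrightarrow>
     (\<forall>\<omega>1 \<omega>2. \<omega>1 extreme_point_of \<Omega> \<longrightarrow> \<omega>2 extreme_point_of \<Omega> \<longrightarrow>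
        (\<exists>T\<in>GL \<Omega>. blinfun_apply T \<omega>1 = \<omega>2))"

definition pos_cone :: "'v::euclidean_space set \<Rightarrow> 'v set" where
  "pos_cone \<Omega> = {c *\<^sub>R \<omega> | c \<omega>. c \<ge> 0 \<and> \<omega> \<in> \<Omega>}"

definition internal_dual_cone :: "'v::euclidean_space set \<Rightarrow> 'v set" where
  "internal_dual_cone \<Omega> = {y. \<forall>x\<in>pos_cone \<Omega>. inner_GL \<Omega> x y \<ge> 0}"

definition self_dual_GL :: "'v::euclidean_space set \<Rightarrow> bool" where
  "self_dual_GL \<Omega> \<longleftrightarrow> pos_cone \<Omega> = internal_dual_cone \<Omega>"

definition finite_metric :: "'a set \<Rightarrow> ('a \<Rightarrow> 'a \<Rightarrow> real) \<Rightarrow> bool" where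
  "finite_metric A d \<longleftrightarrow> finite A \<and>
     (\<forall>x\<in>A. \<forall>y\<in>A. (d x y = 0 \<longleftrightarrow> x = y) \<and> d x y = d y x) \<and>
     (\<forall>x\<in>A. \<forall>y\<in>A. \<forall>z\<in>A. d x z \<le> d x y + d y z)"

definition ball_O :: "'a set \<Rightarrow> ('a \<Rightarrow> 'a \<Rightarrow> real) \<Rightarrow> 'a \<Rightarrow> real \<Rightarrow> 'a set" where
  "ball_O A d a w = {x\<in>A. d x a \<le> w / 2}"

definition overall_width ::
  "'a set \<Rightarrow> ('a \<Rightarrow> 'a \<Rightarrow> real) \<Rightarrow> real \<Rightarrow> ('a \<Rightarrow> 'v \<Rightarrow> real) \<Rightarrow> 'v \<Rightarrow> real" where
  "overall_width A d \<epsilon> f \<omega> =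
     Inf {w. w > 0 \<and> (\<exists>a\<in>A. (\<Sum>a'\<in>ball_O A d a w. f a' \<omega>) \<ge> 1 - \<epsilon>)}"

definition error_bar_width ::
  "'v set \<Rightarrow> 'a set \<Rightarrow> ('a \<Rightarrow> 'a \<Rightarrow> real) \<Rightarrow> real \<Rightarrow> ('a \<Rightarrow> 'v \<Rightarrow> real) \<Rightarrow> ('a \<Rightarrow> 'v \<Rightarrow> real) \<Rightarrow> real" where
  "error_bar_width \<Omega> A d \<epsilon> ft f =
     Inf {w. w > 0 \<and> (\<forall>a\<in>A. \<forall>\<omega>\<in>\<Omega>. f a \<omega> = 1 \<longrightarrow> (\<Sum>a'\<in>ball_O A d a w. ft a' \<omega>) \<ge> 1 - \<epsilon>)}"

end

theory Submission
  imports Defs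
begin

text \<open>
  The form \<open>inner_GL\<close> is only meaningful if the Haar measure of \<open>GL \<Omega>\<close> exists and is unique.
  For a compact group \<open>G\<close> of linear maps it is obtained as follows. For almost every matrix \<open>A\<close> the
  linear functional \<open>R \<mapsto> tr (R\<^sup>T A)\<close> has a unique maximizer \<open>r A\<close> on \<open>G\<close>, and \<open>S (r (S\<^sup>T A)) = r A\<close>
  for \<open>S\<close> in \<open>G\<close>. Lebesgue measure on a bounded open \<open>G\<close>-invariant set of matrices is invariant, so its
  normalized image under \<open>r\<close> is a left-invariant probability measure. Its image under inversion is
  right-invariant, and Fubini identifies any left-invariant with any right-invariant one.

  Transitivity makes all extreme states equally long for \<open>inner_GL\<close>. Hence, by self-duality, a pure
  indecomposable effect is a multiple of \<open>inner_GL \<Omega> \<omega>\<close> for a state \<open>\<omega>\<close> on which it takes the value 1,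
  and every effect \<open>f\<close> of an ideal observable is zero or a positive multiple of \<open>inner_GL \<Omega> \<omega>\<close> with
  \<open>f \<omega> = 1\<close>. Represent the effects of the joint observable as \<open>inner_GL \<Omega> (c \<omega>)\<close> with states
  \<open>\<omega>\<close>. By symmetry of the form, the calibration bounds for the marginals become bounds on the
  \<open>c\<close>-weighted average over these states of the probabilities that \<open>F\<close> and \<open>G\<close> land near the
  respective outcome. One of the states must then satisfy both width bounds.
\<close>

section \<open>Lebesgue measure and linear maps\<close>

lemma nn_integral_lborel_translate:
  fixes f :: "'a::euclidean_space \<Rightarrow> ennreal"
  assumes [measurable]: "f \<in> borel_measurable borel"
  shows "(\<integral>\<^sup>+x. f (t + x) \<partial>lborel) = (\<integral>\<^sup>+x. f x \<partial>lborel)"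
proof -
  have "(\<integral>\<^sup>+x. f x \<partial>lborel) = (\<integral>\<^sup>+x. f x \<partial>distr lborel borel ((+) t))"
    by (simp add: lborel_distr_plus)
  then show ?thesis by (simp add: nn_integral_distr)
qed

lemma nn_integral_lborel_reflect:
  fixes f :: "'a::euclidean_space \<Rightarrow> ennreal"
  assumes [measurable]: "f \<in> borel_measurable borel"
  shows "(\<integral>\<^sup>+x. f (t - x) \<partial>lborel) = (\<integral>\<^sup>+x. f x \<partial>lborel)"
proof -
  have "lborel = distr lborel borel (\<lambda>x::'a. t - x)"
    using lborel_affine[of "-1" t] by (simp add: density_1)
  then have "(\<integral>\<^sup>+x. f x \<partial>lborel) = (\<integral>\<^sup>+x. f x \<partial>distr lborel borel (\<lambda>x. t - x))"
    by simp
  then show ?thesis by (simp add: nn_integral_distr)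
qed

text \<open>The double integral of \<open>1\<^sub>E(x) 1\<^sub>C(x + L y)\<close>, evaluated in the two orders, compares the
  measures of \<open>E\<close> and \<open>L -` E\<close> without recourse to determinants.\<close>

lemma lborel_distr_linear_invariant_set:
  fixes L :: "'a::euclidean_space \<Rightarrow> 'a"
  assumes L: "linear L" and surj: "surj L"
    and C: "C \<in> sets borel" "emeasure lborel C \<noteq> 0" "emeasure lborel C \<noteq> \<infinity>"
    and inv: "L -` C = C"
  shows "distr lborel borel L = lborel"
proof (rule measure_eqI)
  have [measurable]: "L \<in> borel_measurable borel"
    by (intro borel_measurable_continuous_onI linear_continuous_on linear_conv_bounded_linear[THEN iffD1] L)
  note [measurable] = C(1)
  fix E assume "E \<in> sets (distr lborel borel L)"
  then have [measurable]: "E \<in> sets borel" by simp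
  \<comment> \<open>A right inverse of \<open>L\<close> turns the shift by \<open>x\<close> outside
    \<open>L\<close> into a shift of the integration variable \<open>y\<close> by
    \<open>K x\<close>.\<close>
  obtain K where K: "\<And>x. L (K x) = x" using surj by (metis surj_def)
  have LC: "indicator C (L y) = (indicator C y :: ennreal)" for y
    using inv by (auto simp: indicator_def)
  have inner1: "(\<integral>\<^sup>+y. indicator C (x + L y) \<partial>lborel) = emeasure lborel C" for x
  proof -
    have "(\<integral>\<^sup>+y. indicator C (x + L y) \<partial>lborel) = (\<integral>\<^sup>+y. indicator C (L (K x + y)) \<partial>lborel)"
      by (simp add: linear_add[OF L] K)
    also have "\<dots> = (\<integral>\<^sup>+y. indicator C (K x + y) \<partial>lborel)" by (simp only: LC)
    also have "\<dots> = (\<integral>\<^sup>+y. indicator C y \<partial>lborel)" by (rule nn_integral_lborel_translate) simp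
    finally show ?thesis by simp
  qed
  have inner2: "(\<integral>\<^sup>+y. indicator E (x - L y) \<partial>lborel) = emeasure lborel (L -` E)" for x
  proof -
    have "(\<integral>\<^sup>+y. indicator E (x - L y) \<partial>lborel) = (\<integral>\<^sup>+y. indicator E (L (K x - y)) \<partial>lborel)"
      by (simp add: linear_diff[OF L] K)
    also have "\<dots> = (\<integral>\<^sup>+y. indicator E (L y) \<partial>lborel)"
      by (rule nn_integral_lborel_reflect) simp
    also have "\<dots> = (\<integral>\<^sup>+y. indicator (L -` E) y \<partial>lborel)" by (simp add: indicator_vimage[symmetric] o_def)
    also have "\<dots> = emeasure lborel (L -` E)"
      by (rule nn_integral_indicator) (use measurable_sets[of L borel borel E] in simp)
    finally show ?thesis .
  qed
  have "emeasure lborel E * emeasure lborel C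
      = (\<integral>\<^sup>+x. indicator E x * (\<integral>\<^sup>+y. indicator C (x + L y) \<partial>lborel) \<partial>lborel)"
    by (simp add: inner1 nn_integral_multc)
  also have "\<dots> = (\<integral>\<^sup>+x. \<integral>\<^sup>+y. indicator E x * indicator C (x + L y) \<partial>lborel \<partial>lborel)"
    by (simp add: nn_integral_cmult)
  also have "\<dots> = (\<integral>\<^sup>+y. \<integral>\<^sup>+x. indicator E x * indicator C (x + L y) \<partial>lborel \<partial>lborel)"
    by (rule lborel_pair.Fubini') simp
  also have "\<dots> = (\<integral>\<^sup>+y. \<integral>\<^sup>+x. indicator E (x - L y) * indicator C x \<partial>lborel \<partial>lborel)"
  proof (rule nn_integral_cong)
    fix y
    show "(\<integral>\<^sup>+x. indicator E x * indicator C (x + L y) \<partial>lborel)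
        = (\<integral>\<^sup>+x. indicator E (x - L y) * indicator C x \<partial>lborel)"
      using nn_integral_lborel_translate[of "\<lambda>x. indicator E x * indicator C (x + L y)" "- L y"]
      by (simp add: algebra_simps)
  qed
  also have "\<dots> = (\<integral>\<^sup>+x. \<integral>\<^sup>+y. indicator E (x - L y) * indicator C x \<partial>lborel \<partial>lborel)"
    by (rule lborel_pair.Fubini') simp
  also have "\<dots> = (\<integral>\<^sup>+x. emeasure lborel (L -` E) * indicator C x \<partial>lborel)"
    by (simp add: nn_integral_multc inner2)
  also have "\<dots> = emeasure lborel (L -` E) * emeasure lborel C"
    by (simp add: nn_integral_cmult)
  finally have "emeasure lborel E = emeasure lborel (L -` E)"
    using C(2,3) by (simp add: ennreal_mult_cancel_left mult.commute[of _ "emeasure lborel C"])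
  then show "emeasure (distr lborel borel L) E = emeasure lborel E"
    by (simp add: emeasure_distr)
qed simp

text \<open>All translates of \<open>N\<close> by \<open>s *\<^sub>R c\<close> have the same
  measure, so averaging over \<open>s\<close> recovers the measure of \<open>N\<close>; integrating
  along the lines in direction \<open>c\<close> first gives zero.\<close>

lemma null_set_of_lines:
  fixes c :: "'a::euclidean_space"
  assumes N: "N \<in> sets borel"
    and line: "\<And>x. (AE s in lborel. x + s *\<^sub>R c \<notin> N)"
  shows "N \<in> null_sets lborel"
proof -
  note [measurable] = N
  \<comment> \<open>This weight has total mass one, so the average over \<open>s\<close> is the
    measure itself.\<close>
  let ?I = "indicator {0..1::real} :: real \<Rightarrow> ennreal"
  have "emeasure lborel N = (\<integral>\<^sup>+s. ?I s * emeasure lborel N \<partial>lborel)"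
    by (simp add: nn_integral_multc)
  also have "\<dots> = (\<integral>\<^sup>+s. \<integral>\<^sup>+x. ?I s * indicator N (x + s *\<^sub>R c) \<partial>lborel \<partial>lborel)"
  proof (rule nn_integral_cong)
    fix s :: real
    have "(\<integral>\<^sup>+x. indicator N (x + s *\<^sub>R c) \<partial>lborel) = (\<integral>\<^sup>+x. indicator N x \<partial>lborel)"
      using nn_integral_lborel_translate[of "indicator N" "s *\<^sub>R c"] by (simp add: add.commute)
    then show "?I s * emeasure lborel N = (\<integral>\<^sup>+x. ?I s * indicator N (x + s *\<^sub>R c) \<partial>lborel)"
      by (simp add: nn_integral_cmult)
  qed
  also have "\<dots> = (\<integral>\<^sup>+x. \<integral>\<^sup>+s. ?I s * indicator N (x + s *\<^sub>R c) \<partial>lborel \<partial>lborel)"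
    by (rule lborel_pair.Fubini') simp
  also have "\<dots> = (\<integral>\<^sup>+x. 0 \<partial>(lborel :: 'a measure))"
  proof (rule nn_integral_cong)
    fix x
    have "AE s in lborel. ?I s * indicator N (x + s *\<^sub>R c) = 0"
      using line[of x] by eventually_elim simp
    then show "(\<integral>\<^sup>+s. ?I s * indicator N (x + s *\<^sub>R c) \<partial>lborel) = 0"
      by (subst nn_integral_0_iff_AE) auto
  qed
  finally show ?thesis using N by (simp add: null_sets_def)
qed

section \<open>Unique maximizers of linear functionals\<close>

definition maximizers :: "'a::real_inner set \<Rightarrow> 'a \<Rightarrow> 'a set" where
  "maximizers K A = {k \<in> K. \<forall>k'\<in>K. k' \<bullet> A \<le> k \<bullet> A}"

lemma maximizers_nonempty:
  assumes "compact K" "K \<noteq> {}"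
  shows "maximizers K A \<noteq> {}"
proof -
  have "\<exists>k\<in>K. \<forall>k'\<in>K. k' \<bullet> A \<le> k \<bullet> A"
    using assms by (intro continuous_attains_sup continuous_intros)
  then show ?thesis by (auto simp: maximizers_def)
qed

text \<open>Along a convergent sequence of functionals, compactness of \<open>K \<inter> F\<close>
  gives a convergent subsequence of maximizers, whose limit maximizes the limit functional. This is
  the source of all measurability below.\<close>

lemma closed_maximizers_meet:
  fixes K :: "'a::euclidean_space set"
  assumes K: "compact K" and F: "closed F"
  shows "closed {A. maximizers K A \<inter> F \<noteq> {}}"
proof -
  have KF: "compact (K \<inter> F)" using K F by (rule compact_Int_closed)
  have "closed {A. \<exists>k\<in>K \<inter> F. \<forall>k'\<in>K. k' \<bullet> A \<le> k \<bullet> A}"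
  proof (rule closed_sequential_limits[THEN iffD2], intro allI impI, elim conjE)
    fix A :: "nat \<Rightarrow> 'a" and l
    assume A: "\<forall>n. A n \<in> {A. \<exists>k\<in>K \<inter> F. \<forall>k'\<in>K. k' \<bullet> A \<le> k \<bullet> A}" and l: "A \<longlonglongrightarrow> l"
    then obtain k where k: "\<And>n. k n \<in> K \<inter> F" "\<And>n k'. k' \<in> K \<Longrightarrow> k' \<bullet> A n \<le> k n \<bullet> A n"
      using choice[of "\<lambda>n k. k \<in> K \<inter> F \<and> (\<forall>k'\<in>K. k' \<bullet> A n \<le> k \<bullet> A n)"] by blast
    obtain m r where m: "m \<in> K \<inter> F" and r: "strict_mono r" "(k \<circ> r) \<longlonglongrightarrow> m"
      using KF k(1) unfolding compact_def by blast
    have Ar: "(A \<circ> r) \<longlonglongrightarrow> l" using l r(1) by (rule LIMSEQ_subseq_LIMSEQ)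
    have "k' \<bullet> l \<le> m \<bullet> l" if "k' \<in> K" for k'
      by (rule LIMSEQ_le[OF tendsto_inner[OF tendsto_const Ar] tendsto_inner[OF r(2) Ar]])
        (use k(2)[OF that] in auto)
    with m show "l \<in> {A. \<exists>k\<in>K \<inter> F. \<forall>k'\<in>K. k' \<bullet> A \<le> k \<bullet> A}" by blast
  qed
  also have "{A. \<exists>k\<in>K \<inter> F. \<forall>k'\<in>K. k' \<bullet> A \<le> k \<bullet> A} = {A. maximizers K A \<inter> F \<noteq> {}}"
    by (auto simp: maximizers_def)
  finally show ?thesis .
qed

text \<open>Two distinct maximizers differ in some coordinate \<open>c\<close>, where rationals
  \<open>p < q\<close> separate them. For each such triple the exceptional functionals form a closed
  set meeting every line in direction \<open>c\<close> at most once, hence a null set; there are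
  countably many triples.\<close>

lemma AE_unique_maximizer:
  fixes K :: "'a::euclidean_space set"
  assumes K: "compact K" "K \<noteq> {}"
  shows "AE A in lborel. is_singleton (maximizers K A)"
proof -
  define N where "N c p q = {A. maximizers K A \<inter> {k. k \<bullet> c \<le> p} \<noteq> {}} \<inter> {A. maximizers K A \<inter> {k. q \<le> k \<bullet> c} \<noteq> {}}"
    for c p q
  have null: "N c p q \<in> null_sets lborel" if pq: "p < q" for c p q
  proof (rule null_set_of_lines[of _ c])
    have "closed (N c p q)"
      unfolding N_def
      by (intro closed_Int closed_maximizers_meet K closed_Collect_le continuous_intros)
    then show "N c p q \<in> sets borel" by (rule borel_closed)
    fix x
    \<comment> \<open>The slope of a maximizer increases along the line, so the jump across \<open>[p, q]\<close> happens at most once.\<close>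
    have lt: False if st: "s < t" "x + s *\<^sub>R c \<in> N c p q" "x + t *\<^sub>R c \<in> N c p q" for s t
    proof -
      from st(2) obtain k where k: "k \<in> maximizers K (x + s *\<^sub>R c)" "q \<le> k \<bullet> c" by (auto simp: N_def)
      from st(3) obtain m where m: "m \<in> maximizers K (x + t *\<^sub>R c)" "m \<bullet> c \<le> p" by (auto simp: N_def)
      have "m \<bullet> (x + s *\<^sub>R c) \<le> k \<bullet> (x + s *\<^sub>R c)" "k \<bullet> (x + t *\<^sub>R c) \<le> m \<bullet> (x + t *\<^sub>R c)"
        using k(1) m(1) by (auto simp: maximizers_def)
      \<comment> \<open>Adding the two optimality inequalities cancels the terms in
        \<open>x\<close>.\<close>
      then have "(t - s) * (k \<bullet> c) \<le> (t - s) * (m \<bullet> c)" by (simp add: inner_simps algebra_simps)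
      then show False using st(1) k(2) m(2) pq by simp
    qed
    have "\<exists>s0. \<forall>s. x + s *\<^sub>R c \<in> N c p q \<longrightarrow> s = s0"
    proof (cases "\<exists>s0. x + s0 *\<^sub>R c \<in> N c p q")
      case True
      then show ?thesis using lt by (metis linorder_neqE)
    qed auto
    then obtain s0 where "\<And>s. x + s *\<^sub>R c \<in> N c p q \<Longrightarrow> s = s0" by blast
    with AE_lborel_singleton[of s0] show "AE s in lborel. x + s *\<^sub>R c \<notin> N c p q"
      by (auto elim: eventually_mono)
  qed
  have "AE A in lborel. \<forall>c\<in>Basis. \<forall>p\<in>\<rat>. \<forall>q\<in>\<rat>. p < q \<longrightarrow> A \<notin> N c p q"
    by (intro AE_ball_countable[THEN iffD2] countable_rat ballI AE_impI AE_not_in null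
        countable_finite finite_Basis)
  then show ?thesis
  proof eventually_elim
    fix A assume A: "\<forall>c\<in>Basis. \<forall>p\<in>\<rat>. \<forall>q\<in>\<rat>. p < q \<longrightarrow> A \<notin> N c p q"
    have le: "m \<bullet> c \<le> k \<bullet> c" if "k \<in> maximizers K A" "m \<in> maximizers K A" "c \<in> Basis" for k m c
    proof (rule ccontr)
      assume "\<not> m \<bullet> c \<le> k \<bullet> c"
      then obtain p where p: "p \<in> \<rat>" "k \<bullet> c < p" "p < m \<bullet> c" using Rats_dense_in_real[of "k \<bullet> c" "m \<bullet> c"] by auto
      obtain q where "q \<in> \<rat>" "p < q" "q < m \<bullet> c" using Rats_dense_in_real[OF p(3)] by auto
      with p that A show False by (force simp: N_def)
    qed
    obtain k where k: "k \<in> maximizers K A" using maximizers_nonempty[OF K] by blast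
    have "m = k" if "m \<in> maximizers K A" for m
    proof (rule euclidean_eqI)
      fix c :: 'a assume "c \<in> Basis"
      then show "m \<bullet> c = k \<bullet> c" using le[OF k that] le[OF that k] by (simp add: antisym)
    qed
    with k show "is_singleton (maximizers K A)" by (intro is_singletonI') auto
  qed
qed

lemma measurable_maximizer_exists:
  fixes K :: "'a::euclidean_space set"
  assumes K: "compact K" "K \<noteq> {}"
  obtains q where "q \<in> borel_measurable borel" "\<And>A. q A \<in> K"
    "AE A in lborel. maximizers K A = {q A}"
proof -
  obtain N where N: "\<And>A. A \<notin> N \<Longrightarrow> is_singleton (maximizers K A)" "N \<in> null_sets lborel"
    using AE_E3[OF AE_unique_maximizer[OF K]] by auto
  obtain k0 where k0: "k0 \<in> K" using K by blast
  \<comment> \<open>The constant \<open>k0\<close> on the null set keeps all values in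
    \<open>K\<close>. Off the null set, \<open>q A\<close> lies in \<open>F\<close> exactly when the
    set of maximizers meets \<open>F\<close>, which is a closed condition on
    \<open>A\<close>.\<close>
  define q where "q A = (if A \<in> N then k0 else the_elem (maximizers K A))" for A
  have single: "maximizers K A = {q A}" if "A \<notin> N" for A
    using N(1)[OF that] that by (auto simp: q_def is_singleton_the_elem)
  show thesis
  proof
    show "q A \<in> K" for A
    proof (cases "A \<in> N")
      case False
      then have "q A \<in> maximizers K A" using single by blast
      then show ?thesis by (simp add: maximizers_def)
    qed (simp add: q_def k0)
    show "AE A in lborel. maximizers K A = {q A}"
      using AE_not_in[OF N(2)] by eventually_elim (rule single)
    have NM: "N \<in> sets borel" using N(2) by auto
    have "q -` F \<in> sets borel" if F: "closed F" for F
    proof -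
      have "q -` F = (N \<inter> (if k0 \<in> F then UNIV else {})) \<union> ({A. maximizers K A \<inter> F \<noteq> {}} - N)"
        using single by (force simp: q_def)
      moreover have "{A. maximizers K A \<inter> F \<noteq> {}} \<in> sets borel"
        by (intro borel_closed closed_maximizers_meet K F)
      ultimately show ?thesis using NM by auto
    qed
    then have "q -` (- U) \<in> sets borel" if "open U" for U
      using that by blast
    then have "q -` U \<in> sets borel" if "open U" for U
      using that sets.compl_sets[of "q -` (- U)" borel] by (simp add: vimage_Compl Diff_eq)
    then show "q \<in> borel_measurable borel" by (intro borel_measurableI) simp
  qed
qed

section \<open>Linear maps as matrices\<close>

text \<open>An index type with as many elements as \<open>'v\<close> has dimensions, so that matrices over \<open>'v\<close> form a
  Euclidean space and carry \<open>lborel\<close>.\<close>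

typedef (overloaded) 'v basis_index = "Basis :: 'v::euclidean_space set"
  using nonempty_Basis by blast

instance basis_index :: (euclidean_space) finite
proof
  have "UNIV = Abs_basis_index ` (Basis :: 'a set)"
    by (metis (no_types) UNIV_eq_I Rep_basis_index Rep_basis_index_inverse imageI)
  then show "finite (UNIV :: 'a basis_index set)" by (metis finite_Basis finite_imageI)
qed

lemma sum_basis_index: "(\<Sum>i\<in>UNIV. f (Rep_basis_index i)) = (\<Sum>b\<in>Basis. f (b::'v::euclidean_space))"
  by (rule sum.reindex_bij_witness[of _ Abs_basis_index Rep_basis_index])
    (auto simp: Rep_basis_index_inverse Abs_basis_index_inverse Rep_basis_index)

definition columns_of :: "('v::euclidean_space \<Rightarrow>\<^sub>L 'w::euclidean_space) \<Rightarrow> 'w ^ 'v basis_index" where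
  "columns_of T = (\<chi> i. T (Rep_basis_index i))"

text \<open>Recovers a linear map from its columns; as a sum of rank-one operators it is visibly
  continuous in \<open>A\<close>.\<close>

definition of_columns :: "'w::euclidean_space ^ 'v basis_index \<Rightarrow> ('v::euclidean_space \<Rightarrow>\<^sub>L 'w)" where
  "of_columns A = (\<Sum>i\<in>UNIV. blinfun_scaleR_left (A $ i) o\<^sub>L blinfun_inner_right (Rep_basis_index i))"

lemma of_columns_apply: "of_columns A x = (\<Sum>i\<in>UNIV. (Rep_basis_index i \<bullet> x) *\<^sub>R (A $ i))"
  by (simp add: of_columns_def blinfun.sum_left blinfun_inner_right.rep_eq)

lemma of_columns_of [simp]: "of_columns (columns_of T) = T"
proof (rule blinfun_eqI)
  fix x
  have "of_columns (columns_of T) x = (\<Sum>i\<in>UNIV. (Rep_basis_index i \<bullet> x) *\<^sub>R T (Rep_basis_index i))"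
    by (simp add: of_columns_apply columns_of_def)
  also have "\<dots> = (\<Sum>b\<in>Basis. (b \<bullet> x) *\<^sub>R T b)" by (rule sum_basis_index)
  also have "\<dots> = T (\<Sum>b\<in>Basis. (x \<bullet> b) *\<^sub>R b)"
    by (simp add: blinfun.bilinear_simps blinfun.sum_right inner_commute)
  finally show "of_columns (columns_of T) x = T x" by (simp add: euclidean_representation)
qed

lemma continuous_on_columns_of [continuous_intros]: "continuous_on S columns_of"
  unfolding columns_of_def by (intro continuous_intros)

lemma continuous_on_of_columns [continuous_intros]: "continuous_on S of_columns"
  unfolding of_columns_def
  by (intro continuous_intros bounded_linear.continuous_on[OF bounded_linear_blinfun_scaleR_left]
      bounded_bilinear.continuous_on[OF bounded_bilinear_blinfun_compose])

text \<open>A countable basis is pulled back along the embedding \<open>columns_of\<close>. Second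
  countability makes composition, which is continuous in the pair, measurable for measurable
  arguments.\<close>

instance blinfun :: (euclidean_space, euclidean_space) second_countable_topology
proof
  obtain B :: "('b ^ 'a basis_index) set set" where B: "countable B" "topological_basis B"
    using ex_countable_basis by blast
  let ?B = "(\<lambda>U. columns_of -` U) ` B :: ('a \<Rightarrow>\<^sub>L 'b) set set"
  have "topological_basis ?B"
  proof (rule topological_basisI)
    show "open U" if "U \<in> ?B" for U
      using that topological_basis_open[OF B(2)] by (auto intro!: open_vimage continuous_intros)
    fix S :: "('a \<Rightarrow>\<^sub>L 'b) set" and T assume S: "open S" "T \<in> S"
    have "open (of_columns -` S)" by (intro open_vimage S continuous_intros)
    then obtain U where "U \<in> B" "columns_of T \<in> U" "U \<subseteq> of_columns -` S"
      using topological_basisE[OF B(2), of "of_columns -` S" "columns_of T"] S(2) by auto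
    then show "\<exists>U\<in>?B. T \<in> U \<and> U \<subseteq> S"
      by (intro bexI[of _ "columns_of -` U"]) auto
  qed
  then have "open = generate_topology ?B" by (rule topological_basis_imp_subbasis)
  with B(1) show "\<exists>B::('a \<Rightarrow>\<^sub>L 'b) set set. countable B \<and> open = generate_topology B" by blast
qed

lemma measurable_compose_blinfun [measurable (raw)]:
  fixes f :: "'x \<Rightarrow> ('b::euclidean_space \<Rightarrow>\<^sub>L 'c::euclidean_space)"
    and g :: "'x \<Rightarrow> ('a::euclidean_space \<Rightarrow>\<^sub>L 'b)"
  assumes "f \<in> borel_measurable M" "g \<in> borel_measurable M"
  shows "(\<lambda>x. f x o\<^sub>L g x) \<in> borel_measurable M"
  by (rule borel_measurable_continuous_Pair[OF assms])
    (intro continuous_intros bounded_bilinear.continuous_on[OF bounded_bilinear_blinfun_compose])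

lemma linear_blinfun_apply: "linear (blinfun_apply S)"
  by (rule bounded_linear.linear) (rule blinfun.bounded_linear_right)

text \<open>Multiplication by the transpose of \<open>S\<close> on the left, applied columnwise. It
  is the adjoint of composition with \<open>S\<close> and therefore reverses products.\<close>

definition coact :: "('v::euclidean_space \<Rightarrow>\<^sub>L 'v) \<Rightarrow> 'v ^ 'v basis_index \<Rightarrow> 'v ^ 'v basis_index" where
  "coact S A = (\<chi> i. adjoint S (A $ i))"

text \<open>This is what moves maximizers around: on a group containing \<open>S\<close>,
  \<open>R\<close> maximizes the functional of \<open>coact S A\<close> exactly when
  \<open>S o\<^sub>L R\<close> maximizes that of \<open>A\<close>.\<close>

lemma inner_columns_coact: "columns_of R \<bullet> coact S A = columns_of (S o\<^sub>L R) \<bullet> A"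
  by (simp add: inner_vec_def columns_of_def coact_def adjoint_works linear_blinfun_apply)

lemma linear_coact: "linear (coact S)"
proof -
  have "linear (adjoint (blinfun_apply S))" by (rule adjoint_linear) (rule linear_blinfun_apply)
  then show ?thesis
    unfolding coact_def by (intro linearI) (auto simp: vec_eq_iff linear_add linear_scale)
qed

lemma coact_coact: "coact S (coact T A) = coact (T o\<^sub>L S) A"
proof -
  have "adjoint S (adjoint T x) = adjoint (T o\<^sub>L S) x" for x
  proof (rule vector_eq_ldot[THEN iffD1], rule allI)
    fix y
    show "y \<bullet> adjoint S (adjoint T x) = y \<bullet> adjoint (T o\<^sub>L S) x"
      by (simp add: adjoint_works linear_blinfun_apply)
  qed
  then show ?thesis by (simp add: coact_def)
qed

lemma coact_id:
  fixes A :: "'v::euclidean_space ^ 'v basis_index"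
  shows "coact id_blinfun A = A"
proof -
  have "adjoint (blinfun_apply id_blinfun) x = x" for x :: 'v
    by (rule vector_eq_ldot[THEN iffD1]) (simp add: adjoint_works linear_id[unfolded id_def])
  then show ?thesis by (simp add: coact_def vec_eq_iff)
qed

lemma norm_coact_le: "norm (coact S A) \<le> norm S * norm A"
proof -
  have le: "norm (adjoint S x) \<le> norm S * norm x" for x
  proof (cases "adjoint S x = 0")
    case False
    have "norm (adjoint S x) * norm (adjoint S x) = S (adjoint S x) \<bullet> x"
      by (simp add: adjoint_works[symmetric] linear_blinfun_apply dot_square_norm power2_eq_square)
    also have "\<dots> \<le> norm (S (adjoint S x)) * norm x" by (rule norm_cauchy_schwarz)
    also have "\<dots> \<le> (norm S * norm (adjoint S x)) * norm x" by (intro mult_right_mono norm_blinfun) simp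
    finally show ?thesis using False by simp
  qed simp
  have "norm (coact S A) = L2_set (\<lambda>i. norm (adjoint S (A $ i))) UNIV"
    by (simp add: norm_vec_def coact_def)
  also have "\<dots> \<le> L2_set (\<lambda>i. norm S * norm (A $ i)) UNIV"
    by (intro L2_set_mono le) simp
  also have "\<dots> = norm S * norm A" by (simp add: norm_vec_def L2_set_right_distrib)
  finally show ?thesis .
qed

section \<open>Haar measure of a compact linear group\<close>

text \<open>Inverses are only asked to be left inverses within \<open>G\<close>; that they are
  two-sided is derived in \<open>ginv\<close>.\<close>

locale compact_linear_group =
  fixes G :: "('v::euclidean_space \<Rightarrow>\<^sub>L 'v) set"
  assumes compact: "compact G"
    and id_mem: "id_blinfun \<in> G"
    and compose_mem: "S \<in> G \<Longrightarrow> T \<in> G \<Longrightarrow> S o\<^sub>L T \<in> G"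
    and inverse_ex: "T \<in> G \<Longrightarrow> \<exists>S\<in>G. S o\<^sub>L T = id_blinfun"
begin

definition ginv :: "('v \<Rightarrow>\<^sub>L 'v) \<Rightarrow> ('v \<Rightarrow>\<^sub>L 'v)" where
  "ginv T = (SOME S. S \<in> G \<and> S o\<^sub>L T = id_blinfun)"

lemma ginv: assumes "T \<in> G" shows "ginv T \<in> G" "ginv T o\<^sub>L T = id_blinfun" "T o\<^sub>L ginv T = id_blinfun"
proof -
  show l: "ginv T \<in> G" "ginv T o\<^sub>L T = id_blinfun"
    using someI_ex[of "\<lambda>S. S \<in> G \<and> S o\<^sub>L T = id_blinfun"] inverse_ex[OF assms]
    unfolding ginv_def by blast+
  \<comment> \<open>The left inverse \<open>R\<close> of \<open>ginv T\<close> cancels the outer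
    factor in \<open>ginv T (T (ginv T x)) = ginv T x\<close>.\<close>
  obtain R where R: "R o\<^sub>L ginv T = id_blinfun" using inverse_ex[OF l(1)] by blast
  have "R (ginv T x) = x" "ginv T (T x) = x" for x
    using R l(2) by (metis blinfun_apply_blinfun_compose blinfun_apply_id_blinfun)+
  then have "T (ginv T x) = x" for x by metis
  then show "T o\<^sub>L ginv T = id_blinfun" by (intro blinfun_eqI) simp
qed

lemma ginv_apply: assumes "T \<in> G" shows "ginv T (T x) = x" "T (ginv T x) = x"
  using ginv[OF assms] by (metis blinfun_apply_blinfun_compose blinfun_apply_id_blinfun)+

lemma ginv_unique: assumes "T \<in> G" "S o\<^sub>L T = id_blinfun" shows "S = ginv T"
proof (rule blinfun_eqI)
  fix x
  have "S (T (ginv T x)) = ginv T x" using assms(2) by (metis blinfun_apply_blinfun_compose blinfun_apply_id_blinfun)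
  then show "S x = ginv T x" using ginv_apply[OF assms(1)] by simp
qed

lemma ginv_compose: assumes "S \<in> G" "T \<in> G" shows "ginv (S o\<^sub>L T) = ginv T o\<^sub>L ginv S"
  by (rule ginv_unique[symmetric]) (auto intro!: blinfun_eqI compose_mem simp: assms ginv_apply)

lemma norm_bound: obtains c where "0 < c" "\<And>T. T \<in> G \<Longrightarrow> norm T \<le> c"
  using compact_imp_bounded[OF compact] unfolding bounded_pos by blast

lemma borel_group [measurable]: "G \<in> sets borel"
  using compact by (intro borel_closed compact_imp_closed)

text \<open>The difference of two inverses is the product of \<open>ginv S\<close>,
  \<open>T - S\<close> and \<open>ginv T\<close>; the uniform norm bound on \<open>G\<close> makes
  inversion Lipschitz.\<close>

lemma continuous_on_ginv: "continuous_on G ginv"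
proof -
  obtain c where c: "0 < c" "\<And>T. T \<in> G \<Longrightarrow> norm T \<le> c" using norm_bound by blast
  have "dist (ginv S) (ginv T) \<le> (c * c) * dist S T" if "S \<in> G" "T \<in> G" for S T
  proof -
    have "ginv S - ginv T = ginv S o\<^sub>L ((T - S) o\<^sub>L ginv T)"
      using that by (intro blinfun_eqI) (simp add: blinfun.bilinear_simps ginv_apply)
    then have "norm (ginv S - ginv T) \<le> norm (ginv S) * norm ((T - S) o\<^sub>L ginv T)"
      using norm_blinfun_compose[of "ginv S" "(T - S) o\<^sub>L ginv T"] by simp
    also have "\<dots> \<le> norm (ginv S) * (norm (T - S) * norm (ginv T))"
      by (intro mult_left_mono norm_blinfun_compose) simp
    also have "\<dots> \<le> c * (norm (T - S) * c)"
      using that c by (intro mult_mono) (auto simp: ginv)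
    finally show ?thesis by (simp add: dist_norm norm_minus_commute mult_ac)
  qed
  then have "(c * c)-lipschitz_on G ginv" using c by (intro lipschitz_onI) auto
  then show ?thesis by (rule lipschitz_on_continuous_on)
qed

section \<open>Left and right invariant measures coincide\<close>

definition haar_left :: "('v \<Rightarrow>\<^sub>L 'v) measure \<Rightarrow> bool" where
  "haar_left \<mu> \<longleftrightarrow> sets \<mu> = sets borel \<and> prob_space \<mu> \<and> (AE T in \<mu>. T \<in> G) \<and>
     (\<forall>S\<in>G. distr \<mu> borel (\<lambda>T. S o\<^sub>L T) = \<mu>)"

definition haar_right :: "('v \<Rightarrow>\<^sub>L 'v) measure \<Rightarrow> bool" where
  "haar_right \<mu> \<longleftrightarrow> sets \<mu> = sets borel \<and> prob_space \<mu> \<and> (AE T in \<mu>. T \<in> G) \<and>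
     (\<forall>S\<in>G. distr \<mu> borel (\<lambda>T. T o\<^sub>L S) = \<mu>)"

text \<open>The double integral of the indicator of \<open>E\<close> at \<open>R o\<^sub>L T\<close>
  is evaluated in both orders: over \<open>T\<close> first, left invariance gives the measure of
  \<open>E\<close> under \<open>\<mu>\<close>; over \<open>R\<close> first, right invariance gives
  the one under \<open>\<rho>\<close>.\<close>

lemma haar_left_eq_haar_right:
  assumes "haar_left \<mu>" "haar_right \<rho>"
  shows "\<mu> = \<rho>"
proof (rule measure_eqI)
  have [measurable_cong]: "sets \<mu> = sets borel" "sets \<rho> = sets borel"
    using assms by (auto simp: haar_left_def haar_right_def)
  then show "sets \<mu> = sets \<rho>" by simp
  interpret \<mu>: prob_space \<mu> using assms by (simp add: haar_left_def)
  interpret \<rho>: prob_space \<rho> using assms by (simp add: haar_right_def)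
  interpret pair_sigma_finite \<mu> \<rho> ..
  fix E assume "E \<in> sets \<mu>"
  then have [measurable]: "E \<in> sets borel" using assms(1) by (simp add: haar_left_def)
  have l: "(\<integral>\<^sup>+T. indicator E (R o\<^sub>L T) \<partial>\<mu>) = emeasure \<mu> E" if "R \<in> G" for R
  proof -
    have "(\<integral>\<^sup>+T. indicator E (R o\<^sub>L T) \<partial>\<mu>) = (\<integral>\<^sup>+T. indicator E T \<partial>distr \<mu> borel (\<lambda>T. R o\<^sub>L T))"
      by (subst nn_integral_distr) simp_all
    also have "\<dots> = (\<integral>\<^sup>+T. indicator E T \<partial>\<mu>)"
      using assms(1) that by (simp add: haar_left_def)
    finally show ?thesis by simp
  qed
  have r: "(\<integral>\<^sup>+R. indicator E (R o\<^sub>L T) \<partial>\<rho>) = emeasure \<rho> E" if "T \<in> G" for T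
  proof -
    have "(\<integral>\<^sup>+R. indicator E (R o\<^sub>L T) \<partial>\<rho>) = (\<integral>\<^sup>+R. indicator E R \<partial>distr \<rho> borel (\<lambda>R. R o\<^sub>L T))"
      by (subst nn_integral_distr) simp_all
    also have "\<dots> = (\<integral>\<^sup>+R. indicator E R \<partial>\<rho>)"
      using assms(2) that by (simp add: haar_right_def)
    finally show ?thesis by simp
  qed
  have "emeasure \<mu> E = (\<integral>\<^sup>+R. emeasure \<mu> E \<partial>\<rho>)" by (simp add: \<rho>.emeasure_space_1)
  also have "\<dots> = (\<integral>\<^sup>+R. \<integral>\<^sup>+T. indicator E (R o\<^sub>L T) \<partial>\<mu> \<partial>\<rho>)"
    using assms(2) by (intro nn_integral_cong_AE) (auto simp: haar_right_def l elim: eventually_mono)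
  also have "\<dots> = (\<integral>\<^sup>+T. \<integral>\<^sup>+R. indicator E (R o\<^sub>L T) \<partial>\<rho> \<partial>\<mu>)"
    by (rule Fubini') simp
  also have "\<dots> = (\<integral>\<^sup>+T. emeasure \<rho> E \<partial>\<mu>)"
    using assms(1) by (intro nn_integral_cong_AE) (auto simp: haar_left_def r elim: eventually_mono)
  also have "\<dots> = emeasure \<rho> E" by (simp add: \<mu>.emeasure_space_1)
  finally show "emeasure \<mu> E = emeasure \<rho> E" .
qed

text \<open>Inversion turns right multiplication by \<open>S\<close> into left multiplication by
  \<open>ginv S\<close>, so the image of a left-invariant measure under inversion is
  right-invariant.\<close>

lemma haar_right_of_left:
  assumes \<mu>: "haar_left \<mu>"
  shows "\<exists>\<rho>. haar_right \<rho>"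
proof -
  have [measurable_cong]: "sets \<mu> = sets borel" and AE: "AE T in \<mu>. T \<in> G"
    using \<mu> by (auto simp: haar_left_def)
  interpret \<mu>: prob_space \<mu> using \<mu> by (simp add: haar_left_def)
  \<comment> \<open>Extension by zero makes inversion measurable on the whole space;
    \<open>G\<close> has full measure, so the extra value does not matter.\<close>
  define g where "g T = (if T \<in> G then ginv T else 0)" for T
  have [measurable]: "g \<in> borel_measurable borel"
    unfolding g_def by (intro borel_measurable_continuous_on_if continuous_on_ginv continuous_intros) simp
  define \<rho> where "\<rho> = distr \<mu> borel g"
  have "AE T in \<rho>. T \<in> G"
    unfolding \<rho>_def
  proof (subst AE_distr_iff)
    show "AE T in \<mu>. g T \<in> G" using AE by eventually_elim (simp add: g_def ginv)
  qed auto
  moreover have "prob_space \<rho>" unfolding \<rho>_def by (rule \<mu>.prob_space_distr) simp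
  moreover have "distr \<rho> borel (\<lambda>T. T o\<^sub>L S) = \<rho>" if S: "S \<in> G" for S
  proof -
    have "distr \<rho> borel (\<lambda>T. T o\<^sub>L S) = distr \<mu> borel (\<lambda>T. g T o\<^sub>L S)"
      unfolding \<rho>_def by (subst distr_distr) (auto simp: o_def)
    also have "\<dots> = distr \<mu> borel (\<lambda>T. g (ginv S o\<^sub>L T))"
    proof (rule distr_cong_AE)
      show "AE T in \<mu>. g T o\<^sub>L S = g (ginv S o\<^sub>L T)"
        using AE
      proof eventually_elim
        case (elim T)
        have "ginv (ginv S) = S" by (rule ginv_unique[symmetric]) (use S in \<open>auto simp: ginv\<close>)
        with elim S show ?case by (simp add: g_def ginv compose_mem ginv_compose)
      qed
    qed auto
    also have "\<dots> = distr (distr \<mu> borel (\<lambda>T. ginv S o\<^sub>L T)) borel g"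
      by (subst distr_distr) (auto simp: o_def)
    also have "distr \<mu> borel (\<lambda>T. ginv S o\<^sub>L T) = \<mu>"
      using \<mu> S by (simp add: haar_left_def ginv)
    finally show ?thesis by (simp add: \<rho>_def)
  qed
  ultimately show ?thesis unfolding haar_right_def by (intro exI[of _ \<rho>]) (auto simp: \<rho>_def)
qed

text \<open>An invariant replacement for the unit ball, which \<open>coact S\<close> need not
  preserve. As a union of preimages of the open ball it is open, and boundedness of the group keeps
  it bounded.\<close>

definition orbit_ball :: "('v ^ 'v basis_index) set" where
  "orbit_ball = {A. \<exists>S\<in>G. norm (coact S A) < 1}"

lemma open_orbit_ball: "open orbit_ball"
proof -
  have "orbit_ball = (\<Union>S\<in>G. {A. norm (coact S A) < 1})" by (auto simp: orbit_ball_def)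
  moreover have "open {A. norm (coact S A) < 1}" for S
    by (intro open_Collect_less continuous_on_norm continuous_on_const linear_continuous_on
        linear_conv_bounded_linear[THEN iffD1] linear_coact)
  ultimately show ?thesis by auto
qed

lemma zero_mem_orbit_ball: "0 \<in> orbit_ball"
  using id_mem by (auto simp: orbit_ball_def coact_id intro!: bexI[of _ id_blinfun])

lemma bounded_orbit_ball: "bounded orbit_ball"
proof -
  obtain c where c: "0 < c" "\<And>T. T \<in> G \<Longrightarrow> norm T \<le> c" using norm_bound by blast
  have "norm A \<le> c" if A: "A \<in> orbit_ball" for A
  proof -
    obtain S where S: "S \<in> G" "norm (coact S A) < 1" using A by (auto simp: orbit_ball_def)
    have "A = coact (ginv S) (coact S A)" by (simp add: coact_coact ginv S coact_id)
    then have "norm A \<le> norm (ginv S) * norm (coact S A)" by (metis norm_coact_le)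
    also have "\<dots> \<le> c * 1" using S c by (intro mult_mono) (auto simp: ginv)
    finally show ?thesis by simp
  qed
  then show ?thesis by (auto simp: bounded_iff)
qed

lemma vimage_coact_orbit_ball:
  assumes S: "S \<in> G"
  shows "coact S -` orbit_ball = orbit_ball"
proof -
  have "(\<exists>T\<in>G. norm (coact T (coact S A)) < 1) \<longleftrightarrow> (\<exists>T\<in>G. norm (coact T A) < 1)" for A
  proof
    assume "\<exists>T\<in>G. norm (coact T (coact S A)) < 1"
    then show "\<exists>T\<in>G. norm (coact T A) < 1"
      using compose_mem[OF S] by (auto simp: coact_coact)
  next
    assume "\<exists>T\<in>G. norm (coact T A) < 1"
    then obtain T where T: "T \<in> G" "norm (coact T A) < 1" by blast
    \<comment> \<open>By \<open>coact_coact\<close>, the witness \<open>ginv S o\<^sub>L T\<close>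
      applied to \<open>coact S A\<close> yields \<open>coact T A\<close>.\<close>
    have "S o\<^sub>L (ginv S o\<^sub>L T) = T" using S by (intro blinfun_eqI) (simp add: ginv_apply)
    with T S show "\<exists>T\<in>G. norm (coact T (coact S A)) < 1"
      by (intro bexI[of _ "ginv S o\<^sub>L T"]) (auto simp: coact_coact compose_mem ginv)
  qed
  then show ?thesis by (auto simp: orbit_ball_def)
qed

lemma emeasure_orbit_ball: "emeasure lborel orbit_ball \<noteq> 0" "emeasure lborel orbit_ball < \<infinity>"
proof -
  show "emeasure lborel orbit_ball < \<infinity>" by (rule emeasure_bounded_finite[OF bounded_orbit_ball])
  obtain e where e: "e > 0" "ball 0 e \<subseteq> orbit_ball"
    using open_orbit_ball zero_mem_orbit_ball open_contains_ball by blast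
  obtain a b where box: "0 \<in> box a b" "box a b \<subseteq> ball (0 :: 'v ^ 'v basis_index) e"
    using rational_boxes[OF e(1)] by metis
  have "0 < emeasure lborel (box a b)"
    using box(1) by (auto simp: emeasure_lborel_box_eq mem_box algebra_simps intro!: prod_pos)
  also have "\<dots> \<le> emeasure lborel orbit_ball"
    using box(2) e(2) open_orbit_ball by (intro emeasure_mono) auto
  finally show "emeasure lborel orbit_ball \<noteq> 0" by simp
qed

lemma surj_coact: assumes S: "S \<in> G" shows "surj (coact S)"
  by (rule surjI[of _ "coact (ginv S)"]) (simp add: coact_coact ginv S coact_id)

text \<open>The invariant set \<open>orbit_ball\<close> has positive finite measure, which forces
  \<open>coact S\<close> to preserve Lebesgue measure; restriction to the invariant set is then
  preserved as well.\<close>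

lemma distr_uniform_coact:
  assumes S: "S \<in> G"
  shows "distr (uniform_measure lborel orbit_ball) borel (coact S) = uniform_measure lborel orbit_ball"
proof (rule measure_eqI)
  have [measurable]: "coact S \<in> borel_measurable borel"
    by (intro borel_measurable_continuous_onI linear_continuous_on linear_conv_bounded_linear[THEN iffD1] linear_coact)
  have [measurable]: "orbit_ball \<in> sets borel" by (rule borel_open) (rule open_orbit_ball)
  have inv: "distr lborel borel (coact S) = lborel"
    using emeasure_orbit_ball
    by (intro lborel_distr_linear_invariant_set[of _ orbit_ball] linear_coact surj_coact
        vimage_coact_orbit_ball S) auto
  fix E assume "E \<in> sets (distr (uniform_measure lborel orbit_ball) borel (coact S))"
  then have E[measurable]: "E \<in> sets borel" by simp
  have v: "coact S -` E \<in> sets borel" using measurable_sets[of "coact S" borel borel E] by simp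
  have "emeasure lborel (orbit_ball \<inter> coact S -` E) = emeasure lborel (coact S -` (orbit_ball \<inter> E))"
    using vimage_coact_orbit_ball[OF S] by (simp add: vimage_Int)
  also have "\<dots> = emeasure (distr lborel borel (coact S)) (orbit_ball \<inter> E)"
    by (subst emeasure_distr) auto
  also have "\<dots> = emeasure lborel (orbit_ball \<inter> E)" by (simp add: inv)
  finally show "emeasure (distr (uniform_measure lborel orbit_ball) borel (coact S)) E
      = emeasure (uniform_measure lborel orbit_ball) E"
    using v by (simp add: emeasure_distr)
qed simp

text \<open>The measure is the law of the group element \<open>r A\<close> maximizing the functional
  of a uniformly random \<open>A\<close> in \<open>orbit_ball\<close>. Uniqueness of the maximizer
  makes \<open>r\<close> equivariant almost everywhere, and the law of \<open>A\<close> is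
  invariant.\<close>

lemma haar_left_exists: "\<exists>\<mu>. haar_left \<mu>"
proof -
  let ?\<nu> = "uniform_measure lborel orbit_ball"
  have K: "compact (columns_of ` G)" "columns_of ` G \<noteq> {}"
    using compact id_mem by (auto intro!: compact_continuous_image continuous_intros)
  obtain q where q[measurable]: "q \<in> borel_measurable borel" and qK: "\<And>A. q A \<in> columns_of ` G"
    and qmax: "AE A in lborel. maximizers (columns_of ` G) A = {q A}"
    using measurable_maximizer_exists[OF K] by blast
  have [measurable]: "orbit_ball \<in> sets borel" by (rule borel_open) (rule open_orbit_ball)
  interpret \<nu>: prob_space ?\<nu>
    using emeasure_orbit_ball by (intro prob_space_uniform_measure) auto
  define r where "r A = of_columns (q A)" for A
  have [measurable]: "r \<in> borel_measurable borel"
    unfolding r_def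
    by (rule measurable_compose[OF q borel_measurable_continuous_onI]) (intro continuous_intros)
  have rG: "r A \<in> G" and qr: "q A = columns_of (r A)" for A using qK[of A] by (auto simp: r_def)
  have \<nu>max: "AE A in ?\<nu>. maximizers (columns_of ` G) A = {q A}"
    using qmax by (intro AE_uniform_measureI) (auto elim: eventually_mono)
  define \<mu> where "\<mu> = distr ?\<nu> borel r"
  have "AE T in \<mu>. T \<in> G" unfolding \<mu>_def by (subst AE_distr_iff) (auto simp: rG)
  moreover have "prob_space \<mu>" unfolding \<mu>_def by (rule \<nu>.prob_space_distr) simp
  moreover have "distr \<mu> borel (\<lambda>T. S o\<^sub>L T) = \<mu>" if S: "S \<in> G" for S
  proof -
    have [measurable]: "coact S \<in> borel_measurable borel"
      by (intro borel_measurable_continuous_onI linear_continuous_on linear_conv_bounded_linear[THEN iffD1] linear_coact)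
    \<comment> \<open>Uniqueness is needed at \<open>coact S A\<close> too; invariance of the
      uniform measure transports the almost sure statement there.\<close>
    have "AE A in distr ?\<nu> borel (coact S). maximizers (columns_of ` G) A = {q A}"
      using \<nu>max unfolding distr_uniform_coact[OF S] .
    then have "AE A in ?\<nu>. maximizers (columns_of ` G) (coact S A) = {q (coact S A)}"
      by (rule AE_distrD[rotated]) simp
    then have eq: "AE A in ?\<nu>. S o\<^sub>L r (coact S A) = r A"
      using \<nu>max
    proof eventually_elim
      case (elim A)
      have "columns_of (r (coact S A)) \<in> maximizers (columns_of ` G) (coact S A)"
        using elim(1) by (simp add: qr)
      then have max: "columns_of (S o\<^sub>L R) \<bullet> A \<le> columns_of (S o\<^sub>L r (coact S A)) \<bullet> A" if "R \<in> G" for R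
        using that by (auto simp: maximizers_def inner_columns_coact)
      have "columns_of R \<bullet> A \<le> columns_of (S o\<^sub>L r (coact S A)) \<bullet> A" if "R \<in> G" for R
      proof -
        \<comment> \<open>Every element of \<open>G\<close> has the form
          \<open>S o\<^sub>L R'\<close> with \<open>R'\<close> in \<open>G\<close>, so a bound over
          such products is a bound over all of \<open>G\<close>.\<close>
        have "S o\<^sub>L (ginv S o\<^sub>L R) = R" using S by (intro blinfun_eqI) (simp add: ginv_apply)
        then show ?thesis using max[of "ginv S o\<^sub>L R"] that S by (simp add: compose_mem ginv)
      qed
      then have "columns_of (S o\<^sub>L r (coact S A)) \<in> maximizers (columns_of ` G) A"
        by (auto simp: maximizers_def compose_mem S rG)
      then have "columns_of (S o\<^sub>L r (coact S A)) = columns_of (r A)"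
        using elim(2) by (simp add: qr)
      then show ?case by (metis of_columns_of)
    qed
    have "distr \<mu> borel (\<lambda>T. S o\<^sub>L T) = distr ?\<nu> borel (\<lambda>A. S o\<^sub>L r A)"
      unfolding \<mu>_def by (subst distr_distr) (auto simp: o_def)
    also have "\<dots> = distr (distr ?\<nu> borel (coact S)) borel (\<lambda>A. S o\<^sub>L r A)"
      by (simp add: distr_uniform_coact[OF S])
    also have "\<dots> = distr ?\<nu> borel (\<lambda>A. S o\<^sub>L r (coact S A))"
      by (subst distr_distr) (auto simp: o_def)
    also have "\<dots> = distr ?\<nu> borel r"
      using eq by (intro distr_cong_AE) auto
    finally show ?thesis by (simp add: \<mu>_def)
  qed
  ultimately show ?thesis unfolding haar_left_def by (intro exI[of _ \<mu>]) (auto simp: \<mu>_def)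
qed

lemma haar_left_unique: "\<exists>!\<mu>. haar_left \<mu>"
  using haar_left_exists haar_right_of_left haar_left_eq_haar_right by metis

text \<open>\<open>is_haar_GL\<close> demands left invariance, whereas invariance of
  \<open>inner_GL\<close> under the group needs \<open>T\<close> replaced by
  \<open>T o\<^sub>L S\<close>, that is, right invariance.\<close>

lemma haar_left_imp_right: "haar_left \<mu> \<Longrightarrow> haar_right \<mu>"
  using haar_right_of_left haar_left_eq_haar_right by metis

end

section \<open>The symmetry group of a state space\<close>

lemma GL_apply_mem: "T \<in> GL \<Omega> \<Longrightarrow> \<omega> \<in> \<Omega> \<Longrightarrow> blinfun_apply T \<omega> \<in> \<Omega>"
  by (auto simp: GL_def)

text \<open>Such maps are bounded on \<Omega>, which spans the space. Induction over the span gives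
  for each vector a bound uniform in \<open>T\<close>, and finitely many basis vectors control the
  operator norm.\<close>

lemma GL_norm_bound:
  assumes "state_space \<Omega>"
  shows "\<exists>c. \<forall>T. blinfun_apply T ` \<Omega> \<subseteq> \<Omega> \<longrightarrow> norm T \<le> c"
proof -
  obtain m where m: "\<And>\<omega>. \<omega> \<in> \<Omega> \<Longrightarrow> norm \<omega> \<le> m"
    using assms compact_imp_bounded[of \<Omega>] unfolding state_space_def bounded_iff by blast
  have "\<exists>c. \<forall>T. blinfun_apply T ` \<Omega> \<subseteq> \<Omega> \<longrightarrow> norm (blinfun_apply T x) \<le> c" for x
  proof -
    have "x \<in> span \<Omega>" using assms by (simp add: state_space_def)
    then show ?thesis
    proof (induction rule: span_induct_alt)
      case base
      show ?case by (intro exI[of _ 0]) simp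
    next
      case (step c \<omega> y)
      then obtain k where k: "\<And>T. blinfun_apply T ` \<Omega> \<subseteq> \<Omega> \<Longrightarrow> norm (blinfun_apply T y) \<le> k" by blast
      have "norm (blinfun_apply T (c *\<^sub>R \<omega> + y)) \<le> \<bar>c\<bar> * m + k" if T: "blinfun_apply T ` \<Omega> \<subseteq> \<Omega>" for T
      proof -
        have "norm (blinfun_apply T (c *\<^sub>R \<omega> + y)) \<le> \<bar>c\<bar> * norm (blinfun_apply T \<omega>) + norm (blinfun_apply T y)"
          by (simp add: blinfun.bilinear_simps norm_triangle_le)
        moreover have "norm (blinfun_apply T \<omega>) \<le> m" using m T step(1) by blast
        ultimately show ?thesis using k[OF T] by (smt (verit) abs_ge_zero mult_left_mono)
      qed
      then show ?case by blast
    qed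
  qed
  then obtain c where c: "\<And>x T. blinfun_apply T ` \<Omega> \<subseteq> \<Omega> \<Longrightarrow> norm (blinfun_apply T x) \<le> c x" by metis
  have "norm T \<le> (\<Sum>b\<in>Basis. c b)" if "blinfun_apply T ` \<Omega> \<subseteq> \<Omega>" for T
    by (rule order_trans[OF norm_blinfun_euclidean_le sum_mono]) (rule c[OF that])
  then show ?thesis by blast
qed

lemma GL_inverse:
  assumes "T \<in> GL \<Omega>"
  shows "\<exists>S\<in>GL \<Omega>. S o\<^sub>L T = id_blinfun \<and> T o\<^sub>L S = id_blinfun"
proof -
  have bij: "bij (blinfun_apply T)" and im: "blinfun_apply T ` \<Omega> = \<Omega>" using assms by (auto simp: GL_def)
  have "linear (inv (blinfun_apply T))"
    using bij by (intro inj_linear_imp_inv_linear linear_blinfun_apply bij_is_inj)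
  then obtain S where S: "blinfun_apply S = inv (blinfun_apply T)"
    using linear_conv_bounded_linear bounded_linear_Blinfun_apply by blast
  have 1: "blinfun_apply S (blinfun_apply T x) = x" "blinfun_apply T (blinfun_apply S x) = x" for x
    using bij by (simp_all add: S bij_is_inj bij_is_surj surj_f_inv_f)
  have "S \<in> GL \<Omega>"
    using bij im bij_imp_bij_inv[OF bij] image_inv_f_f[OF bij_is_inj[OF bij], of \<Omega>] by (simp add: GL_def S)
  with 1 show ?thesis by (intro bexI[of _ S] conjI blinfun_eqI) auto
qed

text \<open>For closedness, the inverses of a convergent sequence are uniformly bounded. This gives
  the limit a lower norm bound, hence injectivity, and prevents the image of \<Omega> from
  shrinking.\<close>

lemma compact_GL:
  fixes \<Omega> :: "'v::euclidean_space set"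
  assumes \<Omega>: "state_space \<Omega>"
  shows "compact (GL \<Omega>)"
proof -
  obtain c where c: "\<And>T. blinfun_apply T ` \<Omega> \<subseteq> \<Omega> \<Longrightarrow> norm T \<le> c" using GL_norm_bound[OF \<Omega>] by blast
  have cG: "norm T \<le> c" if "T \<in> GL \<Omega>" for T using that c by (auto simp: GL_def)
  have clo: "closed \<Omega>" using \<Omega> by (auto simp: state_space_def compact_imp_closed)
  have "closed (GL \<Omega>)"
  proof (rule closed_sequential_limits[THEN iffD2], intro allI impI, elim conjE)
    fix X :: "nat \<Rightarrow> ('v \<Rightarrow>\<^sub>L 'v)" and T
    assume X: "\<forall>n. X n \<in> GL \<Omega>" and lim: "X \<longlonglongrightarrow> T"
    obtain Y where Y: "\<And>n. Y n \<in> GL \<Omega>" "\<And>n. Y n o\<^sub>L X n = id_blinfun"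
      using choice[of "\<lambda>n S. S \<in> GL \<Omega> \<and> S o\<^sub>L X n = id_blinfun"] GL_inverse X by blast
    have YX: "blinfun_apply (Y n) (blinfun_apply (X n) x) = x" for n x
      using Y(2)[of n] by (metis blinfun_apply_blinfun_compose blinfun_apply_id_blinfun)
    have limx: "(\<lambda>n. blinfun_apply (X n) x) \<longlonglongrightarrow> blinfun_apply T x" for x
      by (intro blinfun.tendsto lim tendsto_const)
    have le: "norm x \<le> c * norm (blinfun_apply T x)" for x
    proof (rule LIMSEQ_le_const[OF tendsto_mult[OF tendsto_const tendsto_norm[OF limx]]], intro exI allI impI)
      fix n
      have "norm x \<le> norm (Y n) * norm (blinfun_apply (X n) x)"
        using norm_blinfun[of "Y n" "blinfun_apply (X n) x"] by (simp add: YX)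
      also have "\<dots> \<le> c * norm (blinfun_apply (X n) x)" using cG[OF Y(1)] by (intro mult_right_mono) auto
      finally show "norm x \<le> c * norm (blinfun_apply (X n) x)" .
    qed
    have lin: "linear (blinfun_apply T)" by (rule linear_blinfun_apply)
    have inj: "inj (blinfun_apply T)"
      unfolding linear_injective_0[OF lin] using le by (metis mult_zero_right norm_le_zero_iff norm_zero)
    then have surj: "surj (blinfun_apply T)" using lin by (intro linear_inj_imp_surj)
    have sub: "blinfun_apply T x \<in> \<Omega>" if "x \<in> \<Omega>" for x
      by (rule closed_sequentially[OF clo _ limx]) (use X that GL_apply_mem in auto)
    \<comment> \<open>The points \<open>Y n (T x)\<close> lie in \<Omega> and converge to
      \<open>x\<close>, because their distance to \<open>x\<close> is at most \<open>c\<close> times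
      that of \<open>T x\<close> to \<open>X n x\<close>.\<close>
    have "x \<in> \<Omega>" if Tx: "blinfun_apply T x \<in> \<Omega>" for x
    proof (rule closed_sequentially[OF clo])
      show "blinfun_apply (Y n) (blinfun_apply T x) \<in> \<Omega>" for n using GL_apply_mem[OF Y(1) Tx] .
      have "(\<lambda>n. c * norm (blinfun_apply T x - blinfun_apply (X n) x)) \<longlonglongrightarrow> c * norm (blinfun_apply T x - blinfun_apply T x)"
        by (intro tendsto_intros limx)
      then have 0: "(\<lambda>n. c * norm (blinfun_apply T x - blinfun_apply (X n) x)) \<longlonglongrightarrow> 0" by simp
      have "norm (blinfun_apply (Y n) (blinfun_apply T x) - x) \<le> c * norm (blinfun_apply T x - blinfun_apply (X n) x)" for n
      proof -
        have "blinfun_apply (Y n) (blinfun_apply T x) - x = blinfun_apply (Y n) (blinfun_apply T x - blinfun_apply (X n) x)"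
          by (simp add: blinfun.bilinear_simps YX)
        also have "norm \<dots> \<le> norm (Y n) * norm (blinfun_apply T x - blinfun_apply (X n) x)" by (rule norm_blinfun)
        also have "\<dots> \<le> c * norm (blinfun_apply T x - blinfun_apply (X n) x)"
          using cG[OF Y(1)] by (intro mult_right_mono) auto
        finally show ?thesis .
      qed
      then have "(\<lambda>n. blinfun_apply (Y n) (blinfun_apply T x) - x) \<longlonglongrightarrow> 0"
        by (intro tendsto_norm_zero_cancel[OF tendsto_sandwich[OF _ _ tendsto_const 0]]) auto
      then show "(\<lambda>n. blinfun_apply (Y n) (blinfun_apply T x)) \<longlonglongrightarrow> x" by (rule LIM_zero_cancel)
    qed
    then have "\<omega> \<in> blinfun_apply T ` \<Omega>" if "\<omega> \<in> \<Omega>" for \<omega>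
      using surjD[OF surj, of \<omega>] that by blast
    with sub have "blinfun_apply T ` \<Omega> = \<Omega>" by blast
    with inj surj show "T \<in> GL \<Omega>" by (simp add: GL_def bij_def)
  qed
  moreover have "bounded (GL \<Omega>)" using cG by (auto simp: bounded_iff)
  ultimately show ?thesis by (simp add: compact_eq_bounded_closed)
qed

lemma compact_linear_group_GL:
  assumes \<Omega>: "state_space \<Omega>"
  shows "compact_linear_group (GL \<Omega>)"
proof
  show "compact (GL \<Omega>)" by (rule compact_GL[OF \<Omega>])
  show "id_blinfun \<in> GL \<Omega>" by (simp add: GL_def bij_id[unfolded id_def])
  show "\<exists>S\<in>GL \<Omega>. S o\<^sub>L T = id_blinfun" if "T \<in> GL \<Omega>" for T using GL_inverse[OF that] by blast
  fix S T assume ST: "S \<in> GL \<Omega>" "T \<in> GL \<Omega>"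
  have "blinfun_apply (S o\<^sub>L T) = blinfun_apply S \<circ> blinfun_apply T" by auto
  moreover have "(blinfun_apply S \<circ> blinfun_apply T) ` \<Omega> = \<Omega>"
    using ST unfolding GL_def image_comp[symmetric] by simp
  ultimately show "S o\<^sub>L T \<in> GL \<Omega>" using ST unfolding GL_def mem_Collect_eq by (metis bij_comp)
qed

lemma haar_GL_props:
  assumes \<Omega>: "state_space \<Omega>"
  shows "sets (haar_GL \<Omega>) = sets borel" "prob_space (haar_GL \<Omega>)" "AE T in haar_GL \<Omega>. T \<in> GL \<Omega>"
    "S \<in> GL \<Omega> \<Longrightarrow> distr (haar_GL \<Omega>) borel (\<lambda>T. T o\<^sub>L S) = haar_GL \<Omega>"
proof -
  interpret compact_linear_group "GL \<Omega>" by (rule compact_linear_group_GL[OF \<Omega>])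
  have "haar_left = is_haar_GL \<Omega>" by (simp add: fun_eq_iff haar_left_def is_haar_GL_def)
  then have "haar_left (haar_GL \<Omega>)" using theI'[OF haar_left_unique] by (simp add: haar_GL_def)
  then have "haar_right (haar_GL \<Omega>)" by (rule haar_left_imp_right)
  then show "sets (haar_GL \<Omega>) = sets borel" "prob_space (haar_GL \<Omega>)" "AE T in haar_GL \<Omega>. T \<in> GL \<Omega>"
    "S \<in> GL \<Omega> \<Longrightarrow> distr (haar_GL \<Omega>) borel (\<lambda>T. T o\<^sub>L S) = haar_GL \<Omega>"
    by (auto simp: haar_right_def)
qed

section \<open>The group-averaged inner product\<close>

context
  fixes \<Omega> :: "'v::euclidean_space set"
  assumes \<Omega>: "state_space \<Omega>"
begin

interpretation prob_space "haar_GL \<Omega>" by (rule haar_GL_props(2)[OF \<Omega>])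

lemma measurable_blinfun_inner:
  "(\<lambda>T. blinfun_apply T x \<bullet> blinfun_apply T y) \<in> borel_measurable (borel :: ('v \<Rightarrow>\<^sub>L 'v) measure)"
  by (intro borel_measurable_continuous_onI continuous_intros)

lemma integrable_GL_inner: "integrable (haar_GL \<Omega>) (\<lambda>T. blinfun_apply T x \<bullet> blinfun_apply T y)"
proof -
  obtain c where c: "\<And>T. T \<in> GL \<Omega> \<Longrightarrow> norm T \<le> c"
    using compact_imp_bounded[OF compact_GL[OF \<Omega>]] by (auto simp: bounded_iff)
  have "norm (blinfun_apply T x \<bullet> blinfun_apply T y) \<le> (c * norm x) * (c * norm y)" if T: "T \<in> GL \<Omega>" for T
  proof -
    have le: "norm (blinfun_apply T z) \<le> c * norm z" for z
      by (rule order_trans[OF norm_blinfun mult_right_mono[OF c[OF T]]]) simp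
    have "norm (blinfun_apply T x \<bullet> blinfun_apply T y) \<le> norm (blinfun_apply T x) * norm (blinfun_apply T y)"
      by (simp add: Cauchy_Schwarz_ineq2)
    also have "\<dots> \<le> (c * norm x) * (c * norm y)"
      by (intro mult_mono le order_trans[OF norm_ge_zero le]) simp
    finally show ?thesis .
  qed
  then have "AE T in haar_GL \<Omega>. norm (blinfun_apply T x \<bullet> blinfun_apply T y) \<le> (c * norm x) * (c * norm y)"
    using haar_GL_props(3)[OF \<Omega>] by (auto elim: eventually_mono)
  then show ?thesis
    by (rule integrable_const_bound)
      (simp add: measurable_cong_sets[OF haar_GL_props(1)[OF \<Omega>] refl] measurable_blinfun_inner)
qed

lemma inner_GL_commute: "inner_GL \<Omega> x y = inner_GL \<Omega> y x"
  by (simp add: inner_GL_def inner_commute)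

lemma inner_GL_add_left: "inner_GL \<Omega> (x + y) z = inner_GL \<Omega> x z + inner_GL \<Omega> y z"
  unfolding inner_GL_def
  by (simp add: blinfun.bilinear_simps inner_simps integrable_GL_inner)

lemma inner_GL_scaleR_left: "inner_GL \<Omega> (c *\<^sub>R x) z = c * inner_GL \<Omega> x z"
  unfolding inner_GL_def by (simp add: blinfun.bilinear_simps)

text \<open>Group elements are injective, so the nonnegative integrand is nonzero almost everywhere
  and its integral cannot vanish.\<close>

lemma inner_GL_pos: assumes "x \<noteq> 0" shows "inner_GL \<Omega> x x > 0"
proof -
  have AE: "AE T in haar_GL \<Omega>. blinfun_apply T x \<bullet> blinfun_apply T x \<noteq> 0"
    using haar_GL_props(3)[OF \<Omega>]
  proof eventually_elim
    case (elim T)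
    then have "inj (blinfun_apply T)" by (simp add: GL_def bij_is_inj)
    then have "blinfun_apply T x \<noteq> blinfun_apply T 0" using assms by (blast dest: injD)
    then show ?case by (simp add: blinfun.bilinear_simps)
  qed
  have "inner_GL \<Omega> x x \<noteq> 0"
  proof
    assume "inner_GL \<Omega> x x = 0"
    then have "AE T in haar_GL \<Omega>. blinfun_apply T x \<bullet> blinfun_apply T x = 0"
      unfolding inner_GL_def by (subst (asm) integral_nonneg_eq_0_iff_AE) (auto simp: integrable_GL_inner)
    with AE have "AE T in haar_GL \<Omega>. False" by eventually_elim simp
    then show False by simp
  qed
  moreover have "inner_GL \<Omega> x x \<ge> 0" unfolding inner_GL_def by (intro integral_nonneg_AE) simp
  ultimately show ?thesis by simp
qed

lemma inner_GL_invariant: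
  assumes "S \<in> GL \<Omega>"
  shows "inner_GL \<Omega> (blinfun_apply S x) (blinfun_apply S y) = inner_GL \<Omega> x y"
proof -
  have "(\<lambda>T :: 'v \<Rightarrow>\<^sub>L 'v. T o\<^sub>L S) \<in> borel_measurable borel"
    by simp
  then have m: "(\<lambda>T. T o\<^sub>L S) \<in> borel_measurable (haar_GL \<Omega>)"
    by (simp add: measurable_cong_sets[OF haar_GL_props(1)[OF \<Omega>] refl])
  have "inner_GL \<Omega> x y = (\<integral>T. blinfun_apply T x \<bullet> blinfun_apply T y \<partial>distr (haar_GL \<Omega>) borel (\<lambda>T. T o\<^sub>L S))"
    by (simp add: haar_GL_props(4)[OF \<Omega> assms] inner_GL_def)
  also have "\<dots> = inner_GL \<Omega> (blinfun_apply S x) (blinfun_apply S y)"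
    by (subst integral_distr[OF m measurable_blinfun_inner]) (simp add: inner_GL_def)
  finally show ?thesis by simp
qed
end

section \<open>Effects in self-dual transitive theories\<close>

text \<open>A functional separating 0 from the affine hull is bounded below there, hence constant
  and positive on it; normalizing gives existence. Spanning gives uniqueness, so the definite
  description is meaningful.\<close>

lemma unit_effect:
  fixes \<Omega> :: "'v::euclidean_space set"
  assumes \<Omega>: "state_space \<Omega>"
  shows "linear (unit_effect \<Omega>)" "\<And>\<omega>. \<omega> \<in> \<Omega> \<Longrightarrow> unit_effect \<Omega> \<omega> = 1"
proof -
  have span: "span \<Omega> = UNIV" and 0: "0 \<notin> affine hull \<Omega>" using \<Omega> by (auto simp: state_space_def)
  obtain a b where ab: "0 < b" "\<And>x. x \<in> affine hull \<Omega> \<Longrightarrow> b < a \<bullet> x"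
    using separating_hyperplane_closed_0[of "affine hull \<Omega>"] 0
    by (auto simp: closed_affine_hull affine_imp_convex)
  have const: "a \<bullet> x = a \<bullet> y" if xy: "x \<in> affine hull \<Omega>" "y \<in> affine hull \<Omega>" for x y
  proof (rule ccontr)
    assume ne: "a \<bullet> x \<noteq> a \<bullet> y"
    \<comment> \<open>The affine combination with this parameter is where the functional would
      vanish.\<close>
    define t where "t = - (a \<bullet> x) / (a \<bullet> y - a \<bullet> x)"
    have "(1 - t) *\<^sub>R x + t *\<^sub>R y \<in> affine hull \<Omega>"
      using xy by (intro mem_affine affine_affine_hull) auto
    then have "b < a \<bullet> ((1 - t) *\<^sub>R x + t *\<^sub>R y)" by (rule ab)
    also have "\<dots> = a \<bullet> x + t * (a \<bullet> y - a \<bullet> x)" by (simp add: inner_simps algebra_simps)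
    also have "\<dots> = 0" using ne by (simp add: t_def)
    finally show False using ab(1) by simp
  qed
  have "\<Omega> \<noteq> {}" using span by (metis UNIV_I nonempty_Basis all_not_in_conv nonzero_Basis singletonD span_empty)
  then obtain \<omega>0 where \<omega>0: "\<omega>0 \<in> affine hull \<Omega>" by (auto intro: hull_inc)
  define u where "u x = (a \<bullet> x) / (a \<bullet> \<omega>0)" for x
  have u: "linear u" "\<forall>\<omega>\<in>\<Omega>. u \<omega> = 1"
    using const[OF _ \<omega>0] ab(1) ab(2)[OF \<omega>0]
    by (auto intro!: linearI simp: u_def inner_simps add_divide_distrib hull_inc)
  have "v = u" if "linear v \<and> (\<forall>\<omega>\<in>\<Omega>. v \<omega> = 1)" for v
    by (rule ext, rule linear_eq_on_span[of v u \<Omega>]) (use that u span in auto)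
  with u have "\<exists>!u :: 'v \<Rightarrow> real. linear u \<and> (\<forall>\<omega>\<in>\<Omega>. u \<omega> = 1)" by blast
  from theI'[OF this] show "linear (unit_effect \<Omega>)" "\<And>\<omega>. \<omega> \<in> \<Omega> \<Longrightarrow> unit_effect \<Omega> \<omega> = 1"
    by (auto simp: unit_effect_def)
qed

section \<open>Representing functionals by the averaged inner product\<close>

lemma inner_GL_add_right: "state_space \<Omega> \<Longrightarrow> inner_GL \<Omega> z (x + y) = inner_GL \<Omega> z x + inner_GL \<Omega> z y"
  using inner_GL_add_left inner_GL_commute by metis

lemma inner_GL_scaleR_right: "state_space \<Omega> \<Longrightarrow> inner_GL \<Omega> z (c *\<^sub>R x) = c * inner_GL \<Omega> z x"
  using inner_GL_scaleR_left inner_GL_commute by metis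

lemma linear_inner_GL: "state_space \<Omega> \<Longrightarrow> linear (inner_GL \<Omega> z)"
  by (intro linearI) (simp_all add: inner_GL_add_right inner_GL_scaleR_right)

text \<open>Riesz representation for \<open>inner_GL\<close>: the Gram operator \<open>L\<close> is
  injective by definiteness, hence surjective in finite dimension.\<close>

lemma inner_GL_representation:
  assumes \<Omega>: "state_space \<Omega>" and e: "linear e"
  obtains y where "e = inner_GL \<Omega> y"
proof -
  define L where "L y = (\<Sum>b\<in>Basis. inner_GL \<Omega> y b *\<^sub>R b)" for y
  have L: "linear L"
    by (intro linearI)
      (simp_all add: L_def inner_GL_add_left[OF \<Omega>] inner_GL_scaleR_left[OF \<Omega>] scaleR_left_distrib
        sum.distrib scaleR_sum_right)
  have Lb: "L y \<bullet> b = inner_GL \<Omega> y b" if "b \<in> Basis" for y b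
    using that by (simp add: L_def)
  have "y = 0" if "L y = 0" for y
  proof (rule ccontr)
    assume "y \<noteq> 0"
    have "inner_GL \<Omega> y y = 0"
      using linear_eq_stdbasis[OF linear_inner_GL[OF \<Omega>, of y] linear_zero] Lb that
      by (metis inner_zero_left)
    with inner_GL_pos[OF \<Omega> \<open>y \<noteq> 0\<close>] show False by simp
  qed
  then have "inj L" using linear_injective_0[OF L] by blast
  then have "surj L" by (rule linear_inj_imp_surj[OF L])
  then obtain y where "L y = (\<Sum>b\<in>Basis. e b *\<^sub>R b)" by (metis surjD)
  then have "inner_GL \<Omega> y b = e b" if "b \<in> Basis" for b using Lb[OF that, of y] that by simp
  then have "e = inner_GL \<Omega> y"
    by (intro linear_eq_stdbasis e linear_inner_GL[OF \<Omega>]) auto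
  then show thesis by (rule that)
qed

lemma inner_GL_sum_right: "state_space \<Omega> \<Longrightarrow> inner_GL \<Omega> z (\<Sum>i\<in>I. g i) = (\<Sum>i\<in>I. inner_GL \<Omega> z (g i))"
  by (rule linear_sum) (rule linear_inner_GL)

lemma two_inner_GL_le:
  assumes "state_space \<Omega>"
  shows "2 * inner_GL \<Omega> x y \<le> inner_GL \<Omega> x x + inner_GL \<Omega> y y"
proof -
  have "0 \<le> inner_GL \<Omega> (x + (-1) *\<^sub>R y) (x + (-1) *\<^sub>R y)"
    using inner_GL_pos[OF assms, of "x + (-1) *\<^sub>R y"] linear_0[OF linear_inner_GL[OF assms]]
    by (cases "x + (-1) *\<^sub>R y = 0") (auto simp: less_imp_le)
  also have "\<dots> = inner_GL \<Omega> x x + inner_GL \<Omega> y y - 2 * inner_GL \<Omega> x y"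
    unfolding inner_GL_add_right[OF assms] inner_GL_add_left[OF assms] inner_GL_scaleR_right[OF assms]
      inner_GL_scaleR_left[OF assms] inner_GL_commute[OF assms, of y x] by simp
  finally show ?thesis by simp
qed

text \<open>Transitivity and invariance give all extreme points the same length. Balls for the form
  are convex, so Minkowski's theorem makes this the maximal length on \<Omega>, and
  \<open>two_inner_GL_le\<close> bounds the mixed product.\<close>

lemma transitive_inner_GL_le:
  assumes \<Omega>: "state_space \<Omega>" and trans: "transitive_state_space \<Omega>"
    and \<omega>: "\<omega> extreme_point_of \<Omega>" and x: "x \<in> \<Omega>"
  shows "inner_GL \<Omega> \<omega> x \<le> inner_GL \<Omega> \<omega> \<omega>"
proof -
  let ?D = "{x. inner_GL \<Omega> x x \<le> inner_GL \<Omega> \<omega> \<omega>}"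
  have "convex ?D"
  proof (rule convexI)
    fix x y and s t :: real
    assume xy: "x \<in> ?D" "y \<in> ?D" and st: "0 \<le> s" "0 \<le> t" "s + t = 1"
    have "inner_GL \<Omega> (s *\<^sub>R x + t *\<^sub>R y) (s *\<^sub>R x + t *\<^sub>R y)
        = s * s * inner_GL \<Omega> x x + t * t * inner_GL \<Omega> y y + s * t * (2 * inner_GL \<Omega> x y)"
      unfolding inner_GL_add_right[OF \<Omega>] inner_GL_add_left[OF \<Omega>] inner_GL_scaleR_right[OF \<Omega>]
        inner_GL_scaleR_left[OF \<Omega>] inner_GL_commute[OF \<Omega>, of y x] by (simp add: algebra_simps)
    also have "\<dots> \<le> s * s * inner_GL \<Omega> x x + t * t * inner_GL \<Omega> y y + s * t * (inner_GL \<Omega> x x + inner_GL \<Omega> y y)"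
      using st by (intro add_left_mono mult_left_mono two_inner_GL_le[OF \<Omega>]) auto
    also have "\<dots> = (s + t) * (s * inner_GL \<Omega> x x + t * inner_GL \<Omega> y y)"
      by (simp add: algebra_simps)
    also have "\<dots> = s * inner_GL \<Omega> x x + t * inner_GL \<Omega> y y" using st by simp
    also have "\<dots> \<le> inner_GL \<Omega> \<omega> \<omega>"
      using xy st by (intro convex_bound_le) auto
    finally show "s *\<^sub>R x + t *\<^sub>R y \<in> ?D" by simp
  qed
  moreover have "{z. z extreme_point_of \<Omega>} \<subseteq> ?D"
  proof safe
    fix z assume "z extreme_point_of \<Omega>"
    then obtain T where "T \<in> GL \<Omega>" "blinfun_apply T \<omega> = z"
      using trans \<omega> by (auto simp: transitive_state_space_def)
    then show "inner_GL \<Omega> z z \<le> inner_GL \<Omega> \<omega> \<omega>" using inner_GL_invariant[OF \<Omega>] by (metis order_refl)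
  qed
  ultimately have "convex hull {z. z extreme_point_of \<Omega>} \<subseteq> ?D" by (intro hull_minimal)
  then have "x \<in> ?D"
    using Krein_Milman_Minkowski[of \<Omega>] x \<Omega> by (auto simp: state_space_def)
  with two_inner_GL_le[OF \<Omega>, of \<omega> x] show ?thesis by simp
qed

lemma inner_GL_cone_nonneg:
  assumes "self_dual_GL \<Omega>" "x \<in> \<Omega>" "y \<in> \<Omega>"
  shows "inner_GL \<Omega> x y \<ge> 0"
proof -
  have "z \<in> pos_cone \<Omega>" if "z \<in> \<Omega>" for z
    using that by (auto simp: pos_cone_def intro!: exI[of _ 1])
  then show ?thesis using assms by (auto simp: self_dual_GL_def internal_dual_cone_def)
qed

text \<open>Nonnegativity on \<Omega> puts the representing vector into the internal dual cone,
  which is the positive cone by self-duality.\<close>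

lemma effect_representation:
  assumes \<Omega>: "state_space \<Omega>" and sd: "self_dual_GL \<Omega>" and e: "linear e" "\<And>\<omega>. \<omega> \<in> \<Omega> \<Longrightarrow> 0 \<le> e \<omega>"
  obtains c \<omega> where "0 \<le> c" "\<omega> \<in> \<Omega>" "e = inner_GL \<Omega> (c *\<^sub>R \<omega>)"
proof -
  obtain y where y: "e = inner_GL \<Omega> y" using inner_GL_representation[OF \<Omega> e(1)] .
  have "y \<in> internal_dual_cone \<Omega>"
    unfolding internal_dual_cone_def
  proof safe
    fix x assume "x \<in> pos_cone \<Omega>"
    then obtain c \<omega> where "x = c *\<^sub>R \<omega>" "c \<ge> 0" "\<omega> \<in> \<Omega>" by (auto simp: pos_cone_def)
    then show "0 \<le> inner_GL \<Omega> x y"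
      using e(2)[of \<omega>] unfolding y inner_GL_commute[OF \<Omega>, of x] by (simp add: inner_GL_scaleR_right[OF \<Omega>])
  qed
  then have "y \<in> pos_cone \<Omega>" using sd by (simp add: self_dual_GL_def)
  then obtain c \<omega> where "y = c *\<^sub>R \<omega>" "0 \<le> c" "\<omega> \<in> \<Omega>" by (auto simp: pos_cone_def)
  with y that show thesis by blast
qed

lemma inner_GL_inj:
  assumes \<Omega>: "state_space \<Omega>" and eq: "inner_GL \<Omega> x = inner_GL \<Omega> y"
  shows "x = y"
proof (rule ccontr)
  assume "x \<noteq> y"
  let ?z = "x + (-1) *\<^sub>R y"
  have "?z \<noteq> 0" using \<open>x \<noteq> y\<close> by simp
  then have "inner_GL \<Omega> ?z ?z > 0" by (rule inner_GL_pos[OF \<Omega>])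
  moreover have "inner_GL \<Omega> ?z ?z = inner_GL \<Omega> x ?z - inner_GL \<Omega> y ?z"
    unfolding inner_GL_add_left[OF \<Omega>, of x] inner_GL_scaleR_left[OF \<Omega>] by simp
  ultimately show False using eq by simp
qed

text \<open>If the maximum \<open>e x\<close> were below 1, then \<open>e\<close> would be a proper
  convex combination of the rescaled effect with maximum 1 and the zero effect.\<close>

lemma pure_effect_attains_one:
  assumes \<Omega>: "state_space \<Omega>" and e: "pure_effect \<Omega> e" "e \<noteq> (\<lambda>v. 0)"
  obtains x where "x \<in> \<Omega>" "e x = 1"
proof -
  have eff: "linear e" "\<And>\<omega>. \<omega> \<in> \<Omega> \<Longrightarrow> 0 \<le> e \<omega> \<and> e \<omega> \<le> 1"
    using e by (auto simp: pure_effect_def effects_def)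
  have span: "span \<Omega> = UNIV" and cpt: "compact \<Omega>" using \<Omega> by (auto simp: state_space_def)
  have ex: "\<exists>\<omega>\<in>\<Omega>. e \<omega> \<noteq> 0"
  proof (rule ccontr)
    assume "\<not> (\<exists>\<omega>\<in>\<Omega>. e \<omega> \<noteq> 0)"
    then have "e v = 0" for v
      using linear_eq_on_span[OF eff(1) linear_zero, of \<Omega> v] span by auto
    then show False using e(2) by auto
  qed
  have "continuous_on \<Omega> e"
    using eff(1) by (intro linear_continuous_on) (simp add: linear_conv_bounded_linear)
  then obtain x where x: "x \<in> \<Omega>" "\<And>y. y \<in> \<Omega> \<Longrightarrow> e y \<le> e x"
    using continuous_attains_sup[OF cpt] ex by blast
  have pos: "0 < e x" using ex x(2) eff(2) by force
  have "\<not> e x < 1"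
  proof
    assume lt: "e x < 1"
    have "(\<lambda>v. e v / e x) \<in> effects \<Omega>"
      using eff x(2) pos
      by (auto simp: effects_def linear_iff add_divide_distrib)
    moreover have "(\<lambda>v. 0) \<in> effects \<Omega>" by (auto simp: effects_def linear_zero)
    moreover have "(\<lambda>v. e v / e x) \<noteq> (\<lambda>v. 0)" using pos by (auto simp: fun_eq_iff intro!: exI[of _ x])
    moreover have "e = (\<lambda>v. e x * (e v / e x) + (1 - e x) * 0)" using pos by auto
    ultimately show False using e(1) pos lt unfolding pure_effect_def by blast
  qed
  with x(1) eff(2)[OF x(1)] show thesis by (intro that[of x]) auto
qed

text \<open>A proper mixture of states at \<omega> splits \<open>e\<close> into two functionals that
  self-duality makes effects. Indecomposability then makes the endpoint \<open>a\<close> a multiple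
  of \<omega>, and the unit effect fixes the factor to be 1.\<close>

lemma indecomposable_effect_extreme:
  assumes \<Omega>: "state_space \<Omega>" and sd: "self_dual_GL \<Omega>"
    and e: "indecomposable_effect \<Omega> e" "e \<in> effects \<Omega>"
    and c: "0 < c" and \<omega>: "\<omega> \<in> \<Omega>" and rep: "e = inner_GL \<Omega> (c *\<^sub>R \<omega>)"
  shows "\<omega> extreme_point_of \<Omega>"
proof (rule ccontr)
  assume "\<not> \<omega> extreme_point_of \<Omega>"
  then obtain a b where ab: "a \<in> \<Omega>" "b \<in> \<Omega>" "\<omega> \<in> open_segment a b"
    using \<omega> by (auto simp: extreme_point_of_def)
  then obtain t where t: "a \<noteq> b" "0 < t" "t < 1" "\<omega> = (1 - t) *\<^sub>R a + t *\<^sub>R b"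
    by (auto simp: in_segment)
  define e1 e2 where "e1 = inner_GL \<Omega> ((c * (1 - t)) *\<^sub>R a)" and "e2 = inner_GL \<Omega> ((c * t) *\<^sub>R b)"
  have sum: "e = (\<lambda>v. e1 v + e2 v)"
    unfolding rep e1_def e2_def inner_GL_add_left[OF \<Omega>, symmetric] t(4) by (simp add: scaleR_right_distrib)
  have nn: "0 \<le> e1 v" "0 \<le> e2 v" if "v \<in> \<Omega>" for v
    using that c t ab inner_GL_cone_nonneg[OF sd]
    by (simp_all add: e1_def e2_def inner_GL_scaleR_left[OF \<Omega>])
  have lin: "linear e1" "linear e2" unfolding e1_def e2_def by (rule linear_inner_GL[OF \<Omega>])+
  have le: "e1 v + e2 v \<le> 1" if "v \<in> \<Omega>" for v
    using e(2) that sum by (auto simp: effects_def)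
  have "e1 \<in> effects \<Omega>" "e2 \<in> effects \<Omega>"
    using nn le lin by (fastforce simp: effects_def)+
  then obtain k where k: "e1 = (\<lambda>v. k * e v)"
    using e(1) sum unfolding indecomposable_effect_def by blast
  then have "inner_GL \<Omega> ((c * (1 - t)) *\<^sub>R a) = inner_GL \<Omega> ((k * c) *\<^sub>R \<omega>)"
    unfolding e1_def rep by (simp add: fun_eq_iff inner_GL_scaleR_left[OF \<Omega>])
  then have eq: "(c * (1 - t)) *\<^sub>R a = (k * c) *\<^sub>R \<omega>" by (rule inner_GL_inj[OF \<Omega>])
  then have "unit_effect \<Omega> ((c * (1 - t)) *\<^sub>R a) = unit_effect \<Omega> ((k * c) *\<^sub>R \<omega>)" by simp
  then have "c * (1 - t) = k * c"
    using unit_effect[OF \<Omega>] ab(1) \<omega> by (simp add: linear_scale)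
  with eq c t have "a = \<omega>" by (metis scaleR_left_imp_eq mult_eq_0_iff diff_gt_0_iff_gt less_irrefl)
  then show False using ab(3) by (simp add: open_segment_def)
qed

text \<open>The representing state is extreme, so transitivity makes \<open>e\<close> maximal there;
  purity makes this maximum 1.\<close>

lemma pure_indecomposable_effect_representation:
  assumes \<Omega>: "state_space \<Omega>" and trans: "transitive_state_space \<Omega>" and sd: "self_dual_GL \<Omega>"
    and e: "pure_effect \<Omega> e" "indecomposable_effect \<Omega> e"
  obtains c \<omega> where "\<omega> \<in> \<Omega>" "e = inner_GL \<Omega> (c *\<^sub>R \<omega>)" "e \<omega> = 1"
proof -
  have eff: "e \<in> effects \<Omega>" and ne: "e \<noteq> (\<lambda>v. 0)"
    using e by (auto simp: pure_effect_def indecomposable_effect_def)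
  obtain c \<omega> where c: "0 \<le> c" "\<omega> \<in> \<Omega>" "e = inner_GL \<Omega> (c *\<^sub>R \<omega>)"
    using effect_representation[OF \<Omega> sd, of e] eff by (auto simp: effects_def)
  have "c \<noteq> 0"
    using ne c(3) inner_GL_scaleR_left[OF \<Omega>, of 0 \<omega>] by (auto simp: fun_eq_iff)
  with c(1) have "0 < c" by simp
  then have ext: "\<omega> extreme_point_of \<Omega>"
    using indecomposable_effect_extreme[OF \<Omega> sd e(2) eff _ c(2,3)] by blast
  obtain x where x: "x \<in> \<Omega>" "e x = 1" using pure_effect_attains_one[OF \<Omega> e(1) ne] .
  have "e x \<le> e \<omega>"
    using transitive_inner_GL_le[OF \<Omega> trans ext x(1)] \<open>0 < c\<close>
    by (simp add: c(3) inner_GL_scaleR_left[OF \<Omega>])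
  moreover have "e \<omega> \<le> 1" using eff c(2) by (auto simp: effects_def)
  ultimately have "e \<omega> = 1" using x(2) by simp
  with c that show thesis by blast
qed

text \<open>A summand \<open>e\<close> represented by \<open>c *\<^sub>R \<omega>\<close> satisfies
  \<open>e y = c * f \<omega>\<close> by symmetry. The value \<open>f \<omega>\<close> is 1 if
  \<open>f\<close> is the sum and 0 if it is the complement, since \<open>e\<close> already exhausts
  the probability at \<omega>.\<close>

lemma ideal_effect_at_representative:
  assumes \<Omega>: "state_space \<Omega>" and trans: "transitive_state_space \<Omega>" and sd: "self_dual_GL \<Omega>"
    and f: "f \<in> effects \<Omega>"
    and es: "\<And>e. e \<in> set es \<Longrightarrow> pure_effect \<Omega> e \<and> indecomposable_effect \<Omega> e"
    and feq: "f = (\<lambda>v. \<Sum>e\<leftarrow>es. e v) \<or> f = (\<lambda>v. unit_effect \<Omega> v - (\<Sum>e\<leftarrow>es. e v))"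
    and rep: "f = inner_GL \<Omega> y"
  shows "f y = unit_effect \<Omega> y"
proof -
  have ge: "1 \<le> (\<Sum>e\<leftarrow>es. e \<omega>)" if "e \<in> set es" "\<omega> \<in> \<Omega>" "e \<omega> = 1" for e \<omega>
  proof -
    have "e \<omega> \<le> sum_list (map (\<lambda>e. e \<omega>) es)"
      using that es by (intro member_le_sum_list) (auto simp: pure_effect_def effects_def)
    then show ?thesis using that by simp
  qed
  have f01: "0 \<le> f \<omega>" "f \<omega> \<le> 1" if "\<omega> \<in> \<Omega>" for \<omega> using f that by (auto simp: effects_def)
  note sym = inner_GL_commute[OF \<Omega>] and scale = inner_GL_scaleR_left[OF \<Omega>]
  from feq show ?thesis
  proof
    assume fs: "f = (\<lambda>v. \<Sum>e\<leftarrow>es. e v)"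
    obtain z where z: "unit_effect \<Omega> = inner_GL \<Omega> z"
      using inner_GL_representation[OF \<Omega> unit_effect(1)[OF \<Omega>]] .
    \<comment> \<open>With \<open>z\<close> representing the unit effect, both sides equal the
      weight of \<open>e\<close>; summing compares \<open>f y\<close> with \<open>f z\<close>, which
      is the unit effect at \<open>y\<close>.\<close>
    have "e y = e z" if mem: "e \<in> set es" for e
    proof -
      obtain c \<omega> where e: "\<omega> \<in> \<Omega>" "e = inner_GL \<Omega> (c *\<^sub>R \<omega>)" "e \<omega> = 1"
        using pure_indecomposable_effect_representation[OF \<Omega> trans sd] es[OF mem] by metis
      have "f \<omega> = unit_effect \<Omega> \<omega>"
        using f01[OF e(1)] ge[OF mem e(1,3)] unit_effect(2)[OF \<Omega> e(1)] by (simp add: fs)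
      then show ?thesis by (simp add: e(2) scale sym[of \<omega>] rep z)
    qed
    then have "(\<Sum>e\<leftarrow>es. e y) = (\<Sum>e\<leftarrow>es. e z)" by (metis (mono_tags, lifting) map_eq_conv)
    then have "f y = f z" by (simp add: fs)
    also have "\<dots> = unit_effect \<Omega> y" by (simp add: z rep sym)
    finally show ?thesis .
  next
    assume fs: "f = (\<lambda>v. unit_effect \<Omega> v - (\<Sum>e\<leftarrow>es. e v))"
    have "e y = 0" if mem: "e \<in> set es" for e
    proof -
      obtain c \<omega> where e: "\<omega> \<in> \<Omega>" "e = inner_GL \<Omega> (c *\<^sub>R \<omega>)" "e \<omega> = 1"
        using pure_indecomposable_effect_representation[OF \<Omega> trans sd] es[OF mem] by metis
      have "f \<omega> = 0"
        using f01[OF e(1)] ge[OF mem e(1,3)] unit_effect(2)[OF \<Omega> e(1)] by (simp add: fs)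
      then show ?thesis by (simp add: e(2) scale sym[of \<omega>] rep)
    qed
    then have "(\<Sum>e\<leftarrow>es. e y) = (\<Sum>e\<leftarrow>es. 0)" by (metis (mono_tags, lifting) map_eq_conv)
    then show ?thesis by (simp add: fs)
  qed
qed

section \<open>Preparation and measurement uncertainty\<close>

text \<open>Evaluating \<open>F a\<close> at its own representing vector and cancelling
  \<open>c\<close> gives certainty at \<omega>. The alternative \<open>c = 0\<close> is the zero
  effect, which is certain in no state.\<close>

lemma ideal_observable_representation:
  assumes \<Omega>: "state_space \<Omega>" and trans: "transitive_state_space \<Omega>" and sd: "self_dual_GL \<Omega>"
    and F: "ideal_observable \<Omega> A F" and a: "a \<in> A"
  obtains c \<omega> where "0 \<le> c" "\<omega> \<in> \<Omega>" "F a = inner_GL \<Omega> (c *\<^sub>R \<omega>)" "c = 0 \<or> F a \<omega> = 1"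
proof -
  have eff: "F a \<in> effects \<Omega>" using F a by (auto simp: ideal_observable_def observable_def)
  obtain c \<omega> where c: "0 \<le> c" "\<omega> \<in> \<Omega>" "F a = inner_GL \<Omega> (c *\<^sub>R \<omega>)"
    using effect_representation[OF \<Omega> sd, of "F a"] eff by (auto simp: effects_def)
  obtain es where es: "\<And>e. e \<in> set es \<Longrightarrow> pure_effect \<Omega> e \<and> indecomposable_effect \<Omega> e"
      "F a = (\<lambda>v. \<Sum>e\<leftarrow>es. e v) \<or> F a = (\<lambda>v. unit_effect \<Omega> v - (\<Sum>e\<leftarrow>es. e v))"
    using F a unfolding ideal_observable_def by blast
  have "F a (c *\<^sub>R \<omega>) = unit_effect \<Omega> (c *\<^sub>R \<omega>)"
    by (rule ideal_effect_at_representative[OF \<Omega> trans sd eff es c(3)])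
  then have "c * F a \<omega> = c"
    using eff unit_effect[OF \<Omega>] c(2) by (simp add: effects_def linear_scale)
  with c that show thesis by auto
qed

text \<open>By symmetry of the form, the calibration condition on the states where \<open>F a\<close> is certain turns into
  a bound on the outcome statistics of \<open>F\<close> in the unnormalized states \<open>v a\<close> representing the
  approximate observable.\<close>

lemma calibrated_imp_concentrated:
  assumes \<Omega>: "state_space \<Omega>" and trans: "transitive_state_space \<Omega>" and sd: "self_dual_GL \<Omega>"
    and F: "ideal_observable \<Omega> A F" and d: "finite_metric A d"
    and cal: "\<And>a \<omega>. a \<in> A \<Longrightarrow> \<omega> \<in> \<Omega> \<Longrightarrow> F a \<omega> = 1 \<Longrightarrow> 1 - \<epsilon> \<le> (\<Sum>a'\<in>ball_O A d a w. inner_GL \<Omega> (v a') \<omega>)"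
    and z: "unit_effect \<Omega> = inner_GL \<Omega> z"
  shows "(1 - \<epsilon>) * unit_effect \<Omega> z \<le> (\<Sum>a'\<in>A. \<Sum>a\<in>ball_O A d a' w. F a (v a'))"
proof -
  have fin: "finite A" and sym: "\<And>x y. x \<in> A \<Longrightarrow> y \<in> A \<Longrightarrow> d x y = d y x"
    using d by (auto simp: finite_metric_def)
  have each: "(1 - \<epsilon>) * F a z \<le> (\<Sum>a'\<in>ball_O A d a w. F a (v a'))" if a: "a \<in> A" for a
  proof -
    obtain c \<omega> where c: "0 \<le> c" "\<omega> \<in> \<Omega>" "F a = inner_GL \<Omega> (c *\<^sub>R \<omega>)" "c = 0 \<or> F a \<omega> = 1"
      using ideal_observable_representation[OF \<Omega> trans sd F a] .
    have Fa: "F a x = c * inner_GL \<Omega> x \<omega>" for x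
      by (simp add: c(3) inner_GL_scaleR_left[OF \<Omega>] inner_GL_commute[OF \<Omega>, of x])
    \<comment> \<open>Since \<open>z\<close> represents the unit effect, pairing with
      \<open>z\<close> reads off the weight of an effect.\<close>
    have "F a z = c"
      using unit_effect(2)[OF \<Omega> c(2)] by (simp add: Fa z)
    moreover have "(\<Sum>a'\<in>ball_O A d a w. F a (v a')) = c * (\<Sum>a'\<in>ball_O A d a w. inner_GL \<Omega> (v a') \<omega>)"
      by (simp add: Fa sum_distrib_left)
    moreover have "(1 - \<epsilon>) * c \<le> c * (\<Sum>a'\<in>ball_O A d a w. inner_GL \<Omega> (v a') \<omega>)"
    proof (cases "c = 0")
      case False
      then have "F a \<omega> = 1" using c(4) by simp
      from mult_left_mono[OF cal[OF a c(2) this] c(1)] show ?thesis by (simp add: mult.commute)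
    qed simp
    ultimately show ?thesis by simp
  qed
  have "unit_effect \<Omega> z = (\<Sum>a\<in>A. F a z)"
    using F unfolding ideal_observable_def observable_def by metis
  then have "(1 - \<epsilon>) * unit_effect \<Omega> z = (\<Sum>a\<in>A. (1 - \<epsilon>) * F a z)" by (simp add: sum_distrib_left)
  also have "\<dots> \<le> (\<Sum>a\<in>A. \<Sum>a'\<in>ball_O A d a w. F a (v a'))" by (intro sum_mono each)
  also have "\<dots> = (\<Sum>a\<in>A. \<Sum>a' | a' \<in> A \<and> d a' a \<le> w / 2. F a (v a'))" by (simp add: ball_O_def)
  \<comment> \<open>Nearness of outcomes is symmetric, so exchanging the sums exchanges the centre
    of the ball with its members.\<close>
  also have "\<dots> = (\<Sum>a'\<in>A. \<Sum>a | a \<in> A \<and> d a' a \<le> w / 2. F a (v a'))"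
    by (rule sum.swap_restrict[OF fin fin])
  also have "\<dots> = (\<Sum>a'\<in>A. \<Sum>a\<in>ball_O A d a' w. F a (v a'))"
    by (intro sum.cong refl) (auto simp: ball_O_def sym)
  finally show ?thesis .
qed

lemma observable_partial_sum:
  assumes "observable \<Omega> A F" and "\<omega> \<in> \<Omega>" "X \<subseteq> Y" "Y \<subseteq> A"
  shows "(\<Sum>a\<in>X. F a \<omega>) \<le> (\<Sum>a\<in>Y. F a \<omega>)"
  using assms by (intro sum_mono2) (auto simp: observable_def effects_def dest: finite_subset)

lemma observable_sum:
  assumes \<Omega>: "state_space \<Omega>" and F: "observable \<Omega> A F" and \<omega>: "\<omega> \<in> \<Omega>"
  shows "(\<Sum>a\<in>A. F a \<omega>) = 1"
proof -
  have "(\<lambda>v. \<Sum>a\<in>A. F a v) = unit_effect \<Omega>" using F by (simp add: observable_def)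
  then have "(\<Sum>a\<in>A. F a \<omega>) = unit_effect \<Omega> \<omega>" by metis
  then show ?thesis using unit_effect(2)[OF \<Omega> \<omega>] by simp
qed

text \<open>Each joint effect is a weight \<open>c p\<close> times a state \<open>s p\<close>. The
  concentration bounds for both marginals, added, bound the weighted average of \<open>h\<close>
  below by \<open>2 - \<epsilon>1 - \<epsilon>2\<close>. Some \<open>p\<close> reaches this, and as
  both terms of \<open>h p\<close> are at most 1, each is at least
  \<open>1 - (\<epsilon>1 + \<epsilon>2)\<close>.\<close>

lemma joint_concentration:
  assumes \<Omega>: "state_space \<Omega>" and trans: "transitive_state_space \<Omega>" and sd: "self_dual_GL \<Omega>"
    and dA: "finite_metric A dA" and dB: "finite_metric B dB"
    and F: "ideal_observable \<Omega> A F" and G: "ideal_observable \<Omega> B G"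
    and M: "observable \<Omega> (A \<times> B) M"
    and calF: "\<And>a \<omega>. a \<in> A \<Longrightarrow> \<omega> \<in> \<Omega> \<Longrightarrow> F a \<omega> = 1 \<Longrightarrow> 1 - \<epsilon>1 \<le> (\<Sum>a'\<in>ball_O A dA a w1. \<Sum>b\<in>B. M (a', b) \<omega>)"
    and calG: "\<And>b \<omega>. b \<in> B \<Longrightarrow> \<omega> \<in> \<Omega> \<Longrightarrow> G b \<omega> = 1 \<Longrightarrow> 1 - \<epsilon>2 \<le> (\<Sum>b'\<in>ball_O B dB b w2. \<Sum>a\<in>A. M (a, b') \<omega>)"
  shows "\<exists>\<omega>\<in>\<Omega>. (\<exists>a\<in>A. 1 - (\<epsilon>1 + \<epsilon>2) \<le> (\<Sum>a'\<in>ball_O A dA a w1. F a' \<omega>)) \<and>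
    (\<exists>b\<in>B. 1 - (\<epsilon>1 + \<epsilon>2) \<le> (\<Sum>b'\<in>ball_O B dB b w2. G b' \<omega>))"
proof -
  have oF: "observable \<Omega> A F" and oG: "observable \<Omega> B G"
    using F G by (auto simp: ideal_observable_def)
  have fin: "finite A" "finite B" using oF oG by (auto simp: observable_def)
  obtain z where z: "unit_effect \<Omega> = inner_GL \<Omega> z"
    using inner_GL_representation[OF \<Omega> unit_effect(1)[OF \<Omega>]] .
  have "\<exists>c \<omega>. 0 \<le> c \<and> \<omega> \<in> \<Omega> \<and> M p = inner_GL \<Omega> (c *\<^sub>R \<omega>)" if "p \<in> A \<times> B" for p
  proof -
    have "M p \<in> effects \<Omega>" using M that by (auto simp: observable_def)
    then have "linear (M p)" "\<And>\<omega>. \<omega> \<in> \<Omega> \<Longrightarrow> 0 \<le> M p \<omega>" by (auto simp: effects_def)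
    from effect_representation[OF \<Omega> sd this] show ?thesis by metis
  qed
  then obtain c s where c: "\<And>p. p \<in> A \<times> B \<Longrightarrow> 0 \<le> c p" and s: "\<And>p. p \<in> A \<times> B \<Longrightarrow> s p \<in> \<Omega>"
    and Mp: "\<And>p. p \<in> A \<times> B \<Longrightarrow> M p = inner_GL \<Omega> (c p *\<^sub>R s p)"
    by metis
  define f where "f a \<omega> = (\<Sum>a'\<in>ball_O A dA a w1. F a' \<omega>)" for a \<omega>
  define g where "g b \<omega> = (\<Sum>b'\<in>ball_O B dB b w2. G b' \<omega>)" for b \<omega>
  have inner_sum: "inner_GL \<Omega> (\<Sum>i\<in>I. h i) x = (\<Sum>i\<in>I. inner_GL \<Omega> (h i) x)" for I x and h :: "'k \<Rightarrow> _"
    unfolding inner_GL_commute[OF \<Omega>, of _ x] by (rule inner_GL_sum_right[OF \<Omega>])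
  have linF: "linear (F a)" if "a \<in> A" for a using oF that by (auto simp: observable_def effects_def)
  have linG: "linear (G b)" if "b \<in> B" for b using oG that by (auto simp: observable_def effects_def)
  have "(1 - \<epsilon>1) * unit_effect \<Omega> z
      \<le> (\<Sum>a\<in>A. \<Sum>a'\<in>ball_O A dA a w1. F a' (\<Sum>b\<in>B. c (a, b) *\<^sub>R s (a, b)))"
  \<comment> \<open>The marginal effect at \<open>a\<close> is represented by the sum over
    \<open>b\<close> of the vectors of the joint effects.\<close>
  proof (rule calibrated_imp_concentrated[OF \<Omega> trans sd F dA _ z])
    fix a \<omega> assume "a \<in> A" "\<omega> \<in> \<Omega>" "F a \<omega> = 1"
    note calF[OF this]
    also have "(\<Sum>a'\<in>ball_O A dA a w1. \<Sum>b\<in>B. M (a', b) \<omega>)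
        = (\<Sum>a'\<in>ball_O A dA a w1. inner_GL \<Omega> (\<Sum>b\<in>B. c (a', b) *\<^sub>R s (a', b)) \<omega>)"
      by (intro sum.cong refl) (auto simp: inner_sum Mp ball_O_def)
    finally show "1 - \<epsilon>1 \<le> \<dots>" .
  qed
  also have "\<dots> = (\<Sum>a\<in>A. \<Sum>b\<in>B. c (a, b) * f a (s (a, b)))"
  proof (rule sum.cong[OF refl])
    fix a
    have "(\<Sum>a'\<in>ball_O A dA a w1. F a' (\<Sum>b\<in>B. c (a, b) *\<^sub>R s (a, b)))
      = (\<Sum>a'\<in>ball_O A dA a w1. \<Sum>b\<in>B. c (a, b) * F a' (s (a, b)))"
      by (intro sum.cong refl) (auto simp: ball_O_def linear_sum[OF linF] linear_scale[OF linF])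
    also have "\<dots> = (\<Sum>b\<in>B. c (a, b) * f a (s (a, b)))"
      by (subst sum.swap) (simp add: f_def sum_distrib_left)
    finally show "(\<Sum>a'\<in>ball_O A dA a w1. F a' (\<Sum>b\<in>B. c (a, b) *\<^sub>R s (a, b))) = \<dots>" .
  qed
  finally have f1: "(1 - \<epsilon>1) * unit_effect \<Omega> z \<le> (\<Sum>a\<in>A. \<Sum>b\<in>B. c (a, b) * f a (s (a, b)))" .
  have "(1 - \<epsilon>2) * unit_effect \<Omega> z
      \<le> (\<Sum>b\<in>B. \<Sum>b'\<in>ball_O B dB b w2. G b' (\<Sum>a\<in>A. c (a, b) *\<^sub>R s (a, b)))"
  proof (rule calibrated_imp_concentrated[OF \<Omega> trans sd G dB _ z])
    fix b \<omega> assume "b \<in> B" "\<omega> \<in> \<Omega>" "G b \<omega> = 1"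
    note calG[OF this]
    also have "(\<Sum>b'\<in>ball_O B dB b w2. \<Sum>a\<in>A. M (a, b') \<omega>)
        = (\<Sum>b'\<in>ball_O B dB b w2. inner_GL \<Omega> (\<Sum>a\<in>A. c (a, b') *\<^sub>R s (a, b')) \<omega>)"
      by (intro sum.cong refl) (auto simp: inner_sum Mp ball_O_def)
    finally show "1 - \<epsilon>2 \<le> \<dots>" .
  qed
  also have "\<dots> = (\<Sum>b\<in>B. \<Sum>a\<in>A. c (a, b) * g b (s (a, b)))"
  proof (rule sum.cong[OF refl])
    fix b
    have "(\<Sum>b'\<in>ball_O B dB b w2. G b' (\<Sum>a\<in>A. c (a, b) *\<^sub>R s (a, b)))
      = (\<Sum>b'\<in>ball_O B dB b w2. \<Sum>a\<in>A. c (a, b) * G b' (s (a, b)))"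
      by (intro sum.cong refl) (auto simp: ball_O_def linear_sum[OF linG] linear_scale[OF linG])
    also have "\<dots> = (\<Sum>a\<in>A. c (a, b) * g b (s (a, b)))"
      by (subst sum.swap) (simp add: g_def sum_distrib_left)
    finally show "(\<Sum>b'\<in>ball_O B dB b w2. G b' (\<Sum>a\<in>A. c (a, b) *\<^sub>R s (a, b))) = \<dots>" .
  qed
  also have "\<dots> = (\<Sum>a\<in>A. \<Sum>b\<in>B. c (a, b) * g b (s (a, b)))" by (rule sum.swap)
  finally have g1: "(1 - \<epsilon>2) * unit_effect \<Omega> z \<le> (\<Sum>a\<in>A. \<Sum>b\<in>B. c (a, b) * g b (s (a, b)))" .
  have "unit_effect \<Omega> z = (\<Sum>p\<in>A \<times> B. M p z)"
    using M unfolding observable_def by metis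
  also have "\<dots> = (\<Sum>p\<in>A \<times> B. c p)"
  proof (rule sum.cong[OF refl])
    fix p assume p: "p \<in> A \<times> B"
    have "M p z = unit_effect \<Omega> (c p *\<^sub>R s p)"
      unfolding z Mp[OF p] by (rule inner_GL_commute[OF \<Omega>])
    then show "M p z = c p" using unit_effect[OF \<Omega>] s[OF p] by (simp add: linear_scale)
  qed
  finally have uz: "unit_effect \<Omega> z = (\<Sum>p\<in>A \<times> B. c p)" .
  define h where "h p = f (fst p) (s p) + g (snd p) (s p)" for p
  have ch: "(2 - \<epsilon>1 - \<epsilon>2) * (\<Sum>p\<in>A \<times> B. c p) \<le> (\<Sum>p\<in>A \<times> B. c p * h p)"
  proof -
    have "(\<Sum>p\<in>A \<times> B. c p * h p)
        = (\<Sum>a\<in>A. \<Sum>b\<in>B. c (a, b) * f a (s (a, b))) + (\<Sum>a\<in>A. \<Sum>b\<in>B. c (a, b) * g b (s (a, b)))"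
      by (simp add: sum.cartesian_product h_def split_def distrib_left sum.distrib)
    with f1 g1 show ?thesis by (simp add: uz algebra_simps)
  qed
  \<comment> \<open>A positive total weight provides an outcome with \<open>c p \<noteq> 0\<close>,
    which makes the averaging inequality strict.\<close>
  have "0 < unit_effect \<Omega> z"
  proof -
    have "z \<noteq> 0"
    proof
      assume "z = 0"
      then have "unit_effect \<Omega> x = 0" for x
        by (simp add: z inner_GL_commute[OF \<Omega>, of 0] linear_0[OF linear_inner_GL[OF \<Omega>]])
      moreover have "A \<times> B \<noteq> {}"
        using M unfolding observable_def by (metis card.empty not_numeral_le_zero)
      then obtain p where "p \<in> A \<times> B" by blast
      ultimately show False using unit_effect(2)[OF \<Omega> s, of p] by simp
    qed
    then show ?thesis unfolding z by (rule inner_GL_pos[OF \<Omega>])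
  qed
  have "\<exists>p\<in>A \<times> B. 2 - \<epsilon>1 - \<epsilon>2 \<le> h p"
  proof (rule ccontr)
    assume "\<not> ?thesis"
    then have lt: "h p < 2 - \<epsilon>1 - \<epsilon>2" if "p \<in> A \<times> B" for p using that by force
    obtain p where p: "p \<in> A \<times> B" "c p \<noteq> 0"
      using \<open>0 < unit_effect \<Omega> z\<close> unfolding uz by (metis less_irrefl sum.neutral)
    have "(\<Sum>p\<in>A \<times> B. c p * h p) < (\<Sum>p\<in>A \<times> B. c p * (2 - \<epsilon>1 - \<epsilon>2))"
    proof (rule sum_strict_mono_ex1)
      show "\<forall>p\<in>A \<times> B. c p * h p \<le> c p * (2 - \<epsilon>1 - \<epsilon>2)"
        by (intro ballI mult_left_mono less_imp_le[OF lt] c)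
      show "\<exists>p\<in>A \<times> B. c p * h p < c p * (2 - \<epsilon>1 - \<epsilon>2)"
      proof
        show "c p * h p < c p * (2 - \<epsilon>1 - \<epsilon>2)"
          using p c[OF p(1)] lt[OF p(1)] by (intro mult_strict_left_mono) auto
      qed (rule p(1))
    qed (simp add: fin)
    also have "\<dots> = (2 - \<epsilon>1 - \<epsilon>2) * (\<Sum>p\<in>A \<times> B. c p)"
      by (simp only: sum_distrib_right[symmetric] mult.commute)
    finally show False using ch by simp
  qed
  then obtain a b where ab: "a \<in> A" "b \<in> B" "2 - \<epsilon>1 - \<epsilon>2 \<le> h (a, b)" by auto
  have \<omega>: "s (a, b) \<in> \<Omega>" using ab s by simp
  have "f a (s (a, b)) \<le> 1"
    using observable_partial_sum[OF oF \<omega>, of "ball_O A dA a w1" A] observable_sum[OF \<Omega> oF \<omega>]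
    by (auto simp: f_def ball_O_def)
  moreover have "g b (s (a, b)) \<le> 1"
    using observable_partial_sum[OF oG \<omega>, of "ball_O B dB b w2" B] observable_sum[OF \<Omega> oG \<omega>]
    by (auto simp: g_def ball_O_def)
  ultimately have "1 - (\<epsilon>1 + \<epsilon>2) \<le> f a (s (a, b))" "1 - (\<epsilon>1 + \<epsilon>2) \<le> g b (s (a, b))"
    using ab(3) by (auto simp: h_def)
  with ab \<omega> show ?thesis unfolding f_def g_def by blast
qed

section \<open>Widths as infima\<close>

lemma ball_O_mono: "w \<le> w' \<Longrightarrow> ball_O A d a w \<subseteq> ball_O A d a w'"
  by (auto simp: ball_O_def)

text \<open>Only finitely many distances occur, so slightly enlarging the width admits no new point;
  the condition is closed, hence continuity from the right.\<close>

lemma ball_O_right_continuous: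
  assumes A: "finite A"
  obtains w' where "w < w'" "\<And>y a. a \<in> A \<Longrightarrow> w \<le> y \<Longrightarrow> y < w' \<Longrightarrow> ball_O A d a y = ball_O A d a w"
proof -
  have ev: "\<forall>\<^sub>F y in at_right w. d x a \<le> y / 2 \<longrightarrow> d x a \<le> w / 2" for x a
  proof (cases "d x a \<le> w / 2")
    case False
    then show ?thesis unfolding eventually_at_right_field by (intro exI[of _ "2 * d x a"]) auto
  qed simp
  have "\<forall>\<^sub>F y in at_right w. \<forall>x\<in>A. \<forall>a\<in>A. d x a \<le> y / 2 \<longrightarrow> d x a \<le> w / 2"
    by (intro eventually_ball_finite A ballI ev)
  then obtain w' where w': "w < w'" "\<And>y x a. w < y \<Longrightarrow> y < w' \<Longrightarrow> x \<in> A \<Longrightarrow> a \<in> A \<Longrightarrow> d x a \<le> y / 2 \<Longrightarrow> d x a \<le> w / 2"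
    unfolding eventually_at_right_field by blast
  have "ball_O A d a y = ball_O A d a w" if "a \<in> A" "w \<le> y" "y < w'" for y a
  proof (cases "w = y")
    case False
    with that have "ball_O A d a y \<subseteq> ball_O A d a w" using w'(2)[of y] by (auto simp: ball_O_def)
    then show ?thesis using ball_O_mono[OF that(2), of A d a] by (rule subset_antisym)
  qed simp
  with w'(1) show thesis by (rule that)
qed

lemma ball_O_eventually_all:
  assumes A: "finite A"
  obtains w where "0 < w" "\<And>a. a \<in> A \<Longrightarrow> ball_O A d a w = A"
proof
  \<comment> \<open>Exceeds twice every distance in absolute value; the summand 1 keeps it positive
    even when all distances vanish.\<close>
  define w where "w = 1 + (\<Sum>x\<in>A. \<Sum>a\<in>A. 2 * \<bar>d x a\<bar>)"
  show "0 < w" unfolding w_def by (intro add_pos_nonneg sum_nonneg) auto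
  fix a assume a: "a \<in> A"
  have "d x a \<le> w / 2" if x: "x \<in> A" for x
  proof -
    have "2 * \<bar>d x a\<bar> \<le> (\<Sum>a\<in>A. 2 * \<bar>d x a\<bar>)" using A a by (intro member_le_sum) auto
    also have "\<dots> \<le> (\<Sum>x\<in>A. \<Sum>a\<in>A. 2 * \<bar>d x a\<bar>)" using A x by (intro member_le_sum) (auto intro: sum_nonneg)
    finally show ?thesis by (simp add: w_def)
  qed
  then show "ball_O A d a w = A" by (auto simp: ball_O_def)
qed

text \<open>Admissible widths exist because large balls are everything. One close enough to the
  infimum has the same balls as the infimum, so the calibration bound holds at the infimum, which
  may be 0.\<close>

lemma error_bar_width_attained:
  assumes A: "finite A" and \<epsilon>: "0 \<le> \<epsilon>" and one: "\<And>\<omega>. \<omega> \<in> \<Omega> \<Longrightarrow> (\<Sum>a\<in>A. ft a \<omega>) = 1"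
  shows "0 \<le> error_bar_width \<Omega> A d \<epsilon> ft f"
    and "\<And>a \<omega>. a \<in> A \<Longrightarrow> \<omega> \<in> \<Omega> \<Longrightarrow> f a \<omega> = 1 \<Longrightarrow>
      1 - \<epsilon> \<le> (\<Sum>a'\<in>ball_O A d a (error_bar_width \<Omega> A d \<epsilon> ft f). ft a' \<omega>)"
proof -
  let ?E = "{w. w > 0 \<and> (\<forall>a\<in>A. \<forall>\<omega>\<in>\<Omega>. f a \<omega> = 1 \<longrightarrow> (\<Sum>a'\<in>ball_O A d a w. ft a' \<omega>) \<ge> 1 - \<epsilon>)}"
  obtain w where "0 < w" "\<And>a. a \<in> A \<Longrightarrow> ball_O A d a w = A" using ball_O_eventually_all[OF A] by blast
  then have "w \<in> ?E" using one \<epsilon> by auto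
  then have ne: "?E \<noteq> {}" by blast
  have bdd: "bdd_below ?E" by (rule bdd_belowI[of _ 0]) auto
  show "0 \<le> error_bar_width \<Omega> A d \<epsilon> ft f"
    unfolding error_bar_width_def using ne by (intro cInf_greatest) auto
  obtain w' where w': "Inf ?E < w'" "\<And>y a. a \<in> A \<Longrightarrow> Inf ?E \<le> y \<Longrightarrow> y < w' \<Longrightarrow> ball_O A d a y = ball_O A d a (Inf ?E)"
    using ball_O_right_continuous[OF A] by blast
  obtain y where y: "y \<in> ?E" "y < w'" using cInf_lessD[OF ne w'(1)] by blast
  have "Inf ?E \<le> y" by (rule cInf_lower[OF y(1) bdd])
  then show "1 - \<epsilon> \<le> (\<Sum>a'\<in>ball_O A d a (error_bar_width \<Omega> A d \<epsilon> ft f). ft a' \<omega>)"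
    if "a \<in> A" "\<omega> \<in> \<Omega>" "f a \<omega> = 1" for a \<omega>
    using y(1) w'(2)[OF that(1) _ y(2)] that unfolding error_bar_width_def by auto
qed

lemma overall_width_le:
  assumes \<Omega>: "state_space \<Omega>" and F: "observable \<Omega> A F" and \<omega>: "\<omega> \<in> \<Omega>" and w: "0 \<le> w"
    and a: "a \<in> A" "1 - \<epsilon> \<le> (\<Sum>a'\<in>ball_O A d a w. F a' \<omega>)"
  shows "overall_width A d \<epsilon> F \<omega> \<le> w"
proof (rule field_le_epsilon)
  \<comment> \<open>The width \<open>w\<close> may be 0 while only positive widths are admissible,
    so \<open>w + e\<close> is tested for every positive \<open>e\<close>.\<close>
  fix e :: real assume e: "0 < e"
  have "(\<Sum>a'\<in>ball_O A d a w. F a' \<omega>) \<le> (\<Sum>a'\<in>ball_O A d a (w + e). F a' \<omega>)"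
    using e by (intro observable_partial_sum[OF F \<omega>] ball_O_mono) (auto simp: ball_O_def)
  then have "w + e \<in> {w. w > 0 \<and> (\<exists>a\<in>A. (\<Sum>a'\<in>ball_O A d a w. F a' \<omega>) \<ge> 1 - \<epsilon>)}"
    using a w e by (auto intro!: bexI[of _ a])
  then show "overall_width A d \<epsilon> F \<omega> \<le> w + e"
    unfolding overall_width_def by (intro cInf_lower bdd_belowI[of _ 0]) auto
qed

theorem theorem3p1:
  fixes \<Omega> :: "'v::euclidean_space set"
    and A :: "'a set" and dA :: "'a \<Rightarrow> 'a \<Rightarrow> real" and F :: "'a \<Rightarrow> 'v \<Rightarrow> real"
    and B :: "'b set" and dB :: "'b \<Rightarrow> 'b \<Rightarrow> real" and G :: "'b \<Rightarrow> 'v \<Rightarrow> real"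
    and M :: "'a \<times> 'b \<Rightarrow> 'v \<Rightarrow> real"
    and \<epsilon>1 \<epsilon>2 :: real
  assumes "state_space \<Omega>"
    and "transitive_state_space \<Omega>"
    and "self_dual_GL \<Omega>"
    and "finite_metric A dA" and "finite_metric B dB"
    and "ideal_observable \<Omega> A F" and "ideal_observable \<Omega> B G"
    and "observable \<Omega> (A \<times> B) M"
    and "0 \<le> \<epsilon>1" and "\<epsilon>1 \<le> 1" and "0 \<le> \<epsilon>2" and "\<epsilon>2 \<le> 1" and "\<epsilon>1 + \<epsilon>2 \<le> 1"
  shows "\<exists>\<omega>\<in>\<Omega>.
     error_bar_width \<Omega> A dA \<epsilon>1 (\<lambda>a v. \<Sum>b\<in>B. M (a, b) v) F \<ge> overall_width A dA (\<epsilon>1 + \<epsilon>2) F \<omega>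
   \<and> error_bar_width \<Omega> B dB \<epsilon>2 (\<lambda>b v. \<Sum>a\<in>A. M (a, b) v) G \<ge> overall_width B dB (\<epsilon>1 + \<epsilon>2) G \<omega>"
proof -
  let ?w1 = "error_bar_width \<Omega> A dA \<epsilon>1 (\<lambda>a v. \<Sum>b\<in>B. M (a, b) v) F"
  let ?w2 = "error_bar_width \<Omega> B dB \<epsilon>2 (\<lambda>b v. \<Sum>a\<in>A. M (a, b) v) G"
  have fin: "finite A" "finite B" using assms(4,5) by (auto simp: finite_metric_def)
  have one: "(\<Sum>a\<in>A. \<Sum>b\<in>B. M (a, b) \<omega>) = 1" if "\<omega> \<in> \<Omega>" for \<omega>
    using observable_sum[OF assms(1,8) that] by (simp add: sum.cartesian_product split_def)
  then have one': "(\<Sum>b\<in>B. \<Sum>a\<in>A. M (a, b) \<omega>) = 1" if "\<omega> \<in> \<Omega>" for \<omega>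
    using that by (subst sum.swap)
  have w1: "0 \<le> ?w1" by (rule error_bar_width_attained(1)[OF fin(1) assms(9) one])
  have w2: "0 \<le> ?w2" by (rule error_bar_width_attained(1)[OF fin(2) assms(11) one'])
  \<comment> \<open>The error bar widths satisfy their own calibration conditions and can be used
    directly as the radii for the joint bound.\<close>
  obtain \<omega> a b where \<omega>: "\<omega> \<in> \<Omega>"
    and a: "a \<in> A" "1 - (\<epsilon>1 + \<epsilon>2) \<le> (\<Sum>a'\<in>ball_O A dA a ?w1. F a' \<omega>)"
    and b: "b \<in> B" "1 - (\<epsilon>1 + \<epsilon>2) \<le> (\<Sum>b'\<in>ball_O B dB b ?w2. G b' \<omega>)"
    using joint_concentration[OF assms(1-8)
        error_bar_width_attained(2)[OF fin(1) assms(9) one] error_bar_width_attained(2)[OF fin(2) assms(11) one']]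
    by blast
  have F: "observable \<Omega> A F" and G: "observable \<Omega> B G"
    using assms(6,7) by (auto simp: ideal_observable_def)
  show ?thesis
  proof (intro bexI[OF _ \<omega>] conjI)
    show "overall_width A dA (\<epsilon>1 + \<epsilon>2) F \<omega> \<le> ?w1"
      using a(2) by (rule overall_width_le[OF assms(1) F \<omega> w1 a(1)])
    show "overall_width B dB (\<epsilon>1 + \<epsilon>2) G \<omega> \<le> ?w2"
      using b(2) by (rule overall_width_le[OF assms(1) G \<omega> w2 b(1)])
  qed
qed

end
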